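(* Let $T>0$, $\sigma>0$, and let $\mu,r\in\mathbb{R}$ be constants with $\theta:=\frac{\mu-r}{\sigma}>0$. For $b\in\mathbb{R}$ let $V_T^{(ho)}$, $V_T^{(fw)}(b)$ and $V_T^{(sk)}(b)$ denote the maxima over constant portfolios $\pi\in[0,1]$ of $\mathbb{E}[\log(X_T^\pi/X_0)]$ for, respectively, the ordinary (honest) trader, the forward insider and the Skorokhod insider (wealth processes defined in the context). Then for all sufficiently negative $b$ the ordinary trader surpasses both insiders: there exists $b_0\in\mathbb{R}$ such that for all $b<b_0$, $$V_T^{(ho)}>V_T^{(fw)}(b)\quad\text{and}\quad V_T^{(ho)}>V_T^{(sk)}(b).$$
   Context: $W=(W_t)_{t\in[0,T]}$ is a standard Brownian motion on Wiener space, $X_0>0$ is a constant, $b\in\mathbb{R}$ is a constant (the terminal value of the driving process known to the insiders). The portfolio $\pi\in[0,1]$ is the proportion of wealth in the risky asset. All wealth processes start from $X_0$. Ordinary trader: the Itô equation $dX_t=[r(1-\pi)+\pi\mu]X_t\,dt+\pi\sigma X_t\,dW_t$. Forward insider: $d^-X_t=\big[r(1-\pi)+\pi\mu-\pi\sigma\frac{W_T-b}{T}\big]X_t\,dt+\pi\sigma X_t\,d^-W_t$ (Russo–Vallois forward integral), whose solution satisfies $\log(X_T/X_0)=\int_0^T\big[r(1-\pi)+\pi\mu-\pi\sigma\frac{W_T-b}{T}-\frac12\pi^2\sigma^2\big]dt+\pi\sigma W_T$. Skorokhod insider: $\delta X_t=\big[(1-\pi)r+\pi\mu+\pi\sigma\frac{b-W_T}{T}\big]X_t\,dt+\pi\sigma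 X_t\,\delta W_t$ (Skorokhod integral), whose solution is $X_t=X_0\exp\big\{\pi\sigma W_t+[(1-\pi)r+\pi\mu+\pi\sigma\frac{b-W_T}{T}-\frac12\pi^2\sigma^2]t+\frac{1}{2T}\pi^2\sigma^2t^2\big\}$. *)

theory Defs
  imports "HOL-Probability.Probability"
begin

section \<open>Brownian motion on [0,T]\<close>

(* As for the coordinate process on Wiener space, every path starts at 0 and is continuous. *)
definition brownian_motion :: "'a measure \<Rightarrow> real \<Rightarrow> (real \<Rightarrow> 'a \<Rightarrow> real) \<Rightarrow> bool" where
  "brownian_motion M T W \<longleftrightarrow>
     prob_space M \<and>
     (\<forall>t\<in>{0..T}. W t \<in> borel_measurable M) \<and>
     (\<forall>\<omega>\<in>space M. W 0 \<omega> = 0 \<and> continuous_on {0..T} (\<lambda>t. W t \<omega>)) \<and>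
     (\<forall>s t. 0 \<le> s \<longrightarrow> s < t \<longrightarrow> t \<le> T \<longrightarrow>
        distributed M lborel (\<lambda>\<omega>. W t \<omega> - W s \<omega>) (normal_density 0 (sqrt (t - s)))) \<and>
     (\<forall>(n::nat) \<tau>. (\<forall>i\<le>n. \<tau> i \<in> {0..T}) \<longrightarrow> (\<forall>i<n. \<tau> i \<le> \<tau> (Suc i)) \<longrightarrow>
        prob_space.indep_vars M (\<lambda>_. borel) (\<lambda>i \<omega>. W (\<tau> (Suc i)) \<omega> - W (\<tau> i) \<omega>) {..<n})"

(* sigma-algebra generated by W s, 0 <= s <= t *)
definition brownian_filtration :: "'a measure \<Rightarrow> (real \<Rightarrow> 'a \<Rightarrow> real) \<Rightarrow> real \<Rightarrow> 'a measure" where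
  "brownian_filtration M W t =
     sigma (space M) {W s -` A \<inter> space M | s A. s \<in> {0..t} \<and> A \<in> sets borel}"

abbreviation time_interval :: "real \<Rightarrow> real measure" where
  "time_interval t \<equiv> restrict_space lborel {0..t}"


section \<open>The Ito integral\<close>

definition simple_integrand ::
  "'a measure \<Rightarrow> (real \<Rightarrow> 'a \<Rightarrow> real) \<Rightarrow> real \<Rightarrow> nat \<Rightarrow> (nat \<Rightarrow> real) \<Rightarrow> (nat \<Rightarrow> 'a \<Rightarrow> real) \<Rightarrow> bool" where
  "simple_integrand M W t n \<tau> \<xi> \<longleftrightarrow>
     (\<forall>i\<le>n. \<tau> i \<in> {0..t}) \<and> (\<forall>i<n. \<tau> i \<le> \<tau> (Suc i)) \<and>
     (\<forall>i<n. \<xi> i \<in> borel_measurable (brownian_filtration M W (\<tau> i)) \<and>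
            integrable M (\<lambda>\<omega>. (\<xi> i \<omega>)\<^sup>2))"

definition simple_process :: "nat \<Rightarrow> (nat \<Rightarrow> real) \<Rightarrow> (nat \<Rightarrow> 'a \<Rightarrow> real) \<Rightarrow> real \<Rightarrow> 'a \<Rightarrow> real" where
  "simple_process n \<tau> \<xi> s \<omega> = (\<Sum>i<n. \<xi> i \<omega> * indicator {\<tau> i<..\<tau> (Suc i)} s)"

definition simple_integral ::
  "(real \<Rightarrow> 'a \<Rightarrow> real) \<Rightarrow> nat \<Rightarrow> (nat \<Rightarrow> real) \<Rightarrow> (nat \<Rightarrow> 'a \<Rightarrow> real) \<Rightarrow> 'a \<Rightarrow> real" where
  "simple_integral W n \<tau> \<xi> \<omega> = (\<Sum>i<n. \<xi> i \<omega> * (W (\<tau> (Suc i)) \<omega> - W (\<tau> i) \<omega>))"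

(* I is a version of the Ito integral of f over [0,t]: f is an L^2(dt x P)-limit of simple
   adapted processes (so f is adapted up to null sets), and I is the L^2(P)-limit of their integrals. *)
definition has_ito_integral ::
  "'a measure \<Rightarrow> (real \<Rightarrow> 'a \<Rightarrow> real) \<Rightarrow> real \<Rightarrow> (real \<Rightarrow> 'a \<Rightarrow> real) \<Rightarrow> ('a \<Rightarrow> real) \<Rightarrow> bool" where
  "has_ito_integral M W t f I \<longleftrightarrow>
     case_prod f \<in> borel_measurable (time_interval t \<Otimes>\<^sub>M M) \<and>
     I \<in> borel_measurable M \<and>
     (\<exists>n \<tau> \<xi>.
        (\<forall>k. simple_integrand M W t (n k) (\<tau> k) (\<xi> k)) \<and>
        (\<lambda>k::nat. \<integral>\<^sup>+(s, \<omega>). ennreal ((f s \<omega> - simple_process (n k) (\<tau> k) (\<xi> k) s \<omega>)\<^sup>2)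
            \<partial>(time_interval t \<Otimes>\<^sub>M M)) \<longlonglongrightarrow> 0 \<and>
        (\<lambda>k. \<integral>\<^sup>+\<omega>. ennreal ((I \<omega> - simple_integral W (n k) (\<tau> k) (\<xi> k) \<omega>)\<^sup>2) \<partial>M) \<longlonglongrightarrow> 0)"


section \<open>The Russo--Vallois forward integral\<close>

definition tendsto_in_probability ::
  "'a measure \<Rightarrow> ('b \<Rightarrow> 'a \<Rightarrow> real) \<Rightarrow> ('a \<Rightarrow> real) \<Rightarrow> 'b filter \<Rightarrow> bool" where
  "tendsto_in_probability M Y Z F \<longleftrightarrow>
     (\<forall>\<delta>>0. ((\<lambda>e. measure M {\<omega>\<in>space M. \<bar>Y e \<omega> - Z \<omega>\<bar> > \<delta>}) \<longlongrightarrow> 0) F)"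

(* W is extended beyond T by the constant W T, hence min (s + e) T. *)
definition has_forward_integral ::
  "'a measure \<Rightarrow> real \<Rightarrow> (real \<Rightarrow> 'a \<Rightarrow> real) \<Rightarrow> real \<Rightarrow> (real \<Rightarrow> 'a \<Rightarrow> real) \<Rightarrow> ('a \<Rightarrow> real) \<Rightarrow> bool" where
  "has_forward_integral M T W t f I \<longleftrightarrow>
     case_prod f \<in> borel_measurable (time_interval t \<Otimes>\<^sub>M M) \<and>
     (AE \<omega> in M. set_integrable lborel {0..t} (\<lambda>s. f s \<omega>)) \<and>
     I \<in> borel_measurable M \<and>
     tendsto_in_probability M
       (\<lambda>e \<omega>. LINT s:{0..t}|lborel. f s \<omega> * ((W (min (s + e) T) \<omega> - W s \<omega>) / e)) I (at_right 0)"


section \<open>The Skorokhod integral\<close>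

(* D [] is a smooth function of the coordinates x 0, ..., x (n-1), bounded together with all its
   partial derivatives; D (i # is) is the partial derivative of D is in direction i. *)
definition smooth_bounded :: "nat \<Rightarrow> (nat list \<Rightarrow> (nat \<Rightarrow> real) \<Rightarrow> real) \<Rightarrow> bool" where
  "smooth_bounded n D \<longleftrightarrow>
     (\<forall>is. set is \<subseteq> {..<n} \<longrightarrow>
        (\<forall>x y. (\<forall>i<n. x i = y i) \<longrightarrow> D is x = D is y) \<and>
        (\<exists>C. \<forall>x. \<bar>D is x\<bar> \<le> C) \<and>
        (\<forall>i<n. \<forall>x. ((\<lambda>z. D is (x(i := z))) has_real_derivative D (i # is) x) (at (x i))))"

definition cylindrical ::
  "(real \<Rightarrow> 'a \<Rightarrow> real) \<Rightarrow> (nat \<Rightarrow> real) \<Rightarrow> (nat list \<Rightarrow> (nat \<Rightarrow> real) \<Rightarrow> real) \<Rightarrow> 'a \<Rightarrow> real" where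
  "cylindrical W \<tau> D \<omega> = D [] (\<lambda>i. W (\<tau> i) \<omega>)"

(* Malliavin derivative at time s of the smooth cylindrical variable above *)
definition malliavin_derivative ::
  "(real \<Rightarrow> 'a \<Rightarrow> real) \<Rightarrow> nat \<Rightarrow> (nat \<Rightarrow> real) \<Rightarrow> (nat list \<Rightarrow> (nat \<Rightarrow> real) \<Rightarrow> real)
     \<Rightarrow> real \<Rightarrow> 'a \<Rightarrow> real" where
  "malliavin_derivative W n \<tau> D s \<omega> =
     (\<Sum>i<n. D [i] (\<lambda>j. W (\<tau> j) \<omega>) * indicator {0..\<tau> i} s)"

(* The divergence operator, i.e. the adjoint of the Malliavin derivative. Integrand and integral
   are functionals of W, which is automatic on Wiener space. *)
definition has_skorokhod_integral ::
  "'a measure \<Rightarrow> real \<Rightarrow> (real \<Rightarrow> 'a \<Rightarrow> real) \<Rightarrow> (real \<Rightarrow> 'a \<Rightarrow> real) \<Rightarrow> ('a \<Rightarrow> real) \<Rightarrow> bool" where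
  "has_skorokhod_integral M T W u I \<longleftrightarrow>
     case_prod u \<in> borel_measurable (time_interval T \<Otimes>\<^sub>M brownian_filtration M W T) \<and>
     integrable (time_interval T \<Otimes>\<^sub>M M) (\<lambda>(s, \<omega>). (u s \<omega>)\<^sup>2) \<and>
     I \<in> borel_measurable (brownian_filtration M W T) \<and>
     integrable M (\<lambda>\<omega>. (I \<omega>)\<^sup>2) \<and>
     (\<forall>n \<tau> D. (\<forall>i<n. \<tau> i \<in> {0..T}) \<longrightarrow> smooth_bounded n D \<longrightarrow>
        (\<integral>\<omega>. I \<omega> * cylindrical W \<tau> D \<omega> \<partial>M) =
        (\<integral>(s, \<omega>). u s \<omega> * malliavin_derivative W n \<tau> D s \<omega> \<partial>(time_interval T \<Otimes>\<^sub>M M)))"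


section \<open>Wealth processes\<close>

definition ordinary_wealth ::
  "'a measure \<Rightarrow> real \<Rightarrow> (real \<Rightarrow> 'a \<Rightarrow> real) \<Rightarrow> real \<Rightarrow> real \<Rightarrow> real \<Rightarrow> real \<Rightarrow> real
     \<Rightarrow> (real \<Rightarrow> 'a \<Rightarrow> real) \<Rightarrow> bool" where
  "ordinary_wealth M T W r \<mu> \<sigma> X0 \<pi> X \<longleftrightarrow>
     integrable (time_interval T \<Otimes>\<^sub>M M) (\<lambda>(s, \<omega>). (X s \<omega>)\<^sup>2) \<and>
     case_prod X \<in> borel_measurable (time_interval T \<Otimes>\<^sub>M M) \<and>
     (\<forall>t\<in>{0..T}. \<exists>I. has_ito_integral M W t (\<lambda>s \<omega>. \<pi> * \<sigma> * X s \<omega>) I \<and>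
        (AE \<omega> in M. X t \<omega> = X0
            + (LINT s:{0..t}|lborel. (r * (1 - \<pi>) + \<pi> * \<mu>) * X s \<omega>) + I \<omega>))"

(* For the two anticipating equations below, the solution meant is the one given by the stated
   closed form; no uniqueness theorem for these equations is presupposed. *)

definition forward_wealth ::
  "'a measure \<Rightarrow> real \<Rightarrow> (real \<Rightarrow> 'a \<Rightarrow> real) \<Rightarrow> real \<Rightarrow> real \<Rightarrow> real \<Rightarrow> real \<Rightarrow> real \<Rightarrow> real
     \<Rightarrow> (real \<Rightarrow> 'a \<Rightarrow> real) \<Rightarrow> bool" where
  "forward_wealth M T W r \<mu> \<sigma> X0 b \<pi> X \<longleftrightarrow>
     case_prod X \<in> borel_measurable (time_interval T \<Otimes>\<^sub>M M) \<and>
     (AE \<omega> in M. set_integrable lborel {0..T} (\<lambda>s. X s \<omega>)) \<and>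
     (\<forall>t\<in>{0..T}. \<exists>I. has_forward_integral M T W t (\<lambda>s \<omega>. \<pi> * \<sigma> * X s \<omega>) I \<and>
        (AE \<omega> in M. X t \<omega> = X0
            + (LINT s:{0..t}|lborel.
                 (r * (1 - \<pi>) + \<pi> * \<mu> - \<pi> * \<sigma> * ((W T \<omega> - b) / T)) * X s \<omega>) + I \<omega>)) \<and>
     (AE \<omega> in M. X T \<omega> > 0 \<and>
        ln (X T \<omega> / X0) =
          (LINT t:{0..T}|lborel.
             r * (1 - \<pi>) + \<pi> * \<mu> - \<pi> * \<sigma> * ((W T \<omega> - b) / T) - 1 / 2 * \<pi>\<^sup>2 * \<sigma>\<^sup>2)
          + \<pi> * \<sigma> * W T \<omega>)"

definition skorokhod_wealth ::
  "'a measure \<Rightarrow> real \<Rightarrow> (real \<Rightarrow> 'a \<Rightarrow> real) \<Rightarrow> real \<Rightarrow> real \<Rightarrow> real \<Rightarrow> real \<Rightarrow> real \<Rightarrow> real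
     \<Rightarrow> (real \<Rightarrow> 'a \<Rightarrow> real) \<Rightarrow> bool" where
  "skorokhod_wealth M T W r \<mu> \<sigma> X0 b \<pi> X \<longleftrightarrow>
     case_prod X \<in> borel_measurable (time_interval T \<Otimes>\<^sub>M M) \<and>
     (AE \<omega> in M. set_integrable lborel {0..T} (\<lambda>s. X s \<omega>)) \<and>
     (\<forall>t\<in>{0..T}. \<exists>I.
        has_skorokhod_integral M T W (\<lambda>s \<omega>. indicator {0..t} s * (\<pi> * \<sigma> * X s \<omega>)) I \<and>
        (AE \<omega> in M. X t \<omega> = X0
            + (LINT s:{0..t}|lborel.
                 ((1 - \<pi>) * r + \<pi> * \<mu> + \<pi> * \<sigma> * ((b - W T \<omega>) / T)) * X s \<omega>) + I \<omega>)) \<and>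
     (\<forall>t\<in>{0..T}. AE \<omega> in M. X t \<omega> = X0 * exp (\<pi> * \<sigma> * W t \<omega>
          + ((1 - \<pi>) * r + \<pi> * \<mu> + \<pi> * \<sigma> * ((b - W T \<omega>) / T) - 1 / 2 * \<pi>\<^sup>2 * \<sigma>\<^sup>2) * t
          + 1 / (2 * T) * \<pi>\<^sup>2 * \<sigma>\<^sup>2 * t\<^sup>2))"


section \<open>Optimal expected logarithmic growth\<close>

definition expected_log_growth :: "'a measure \<Rightarrow> real \<Rightarrow> real \<Rightarrow> (real \<Rightarrow> 'a \<Rightarrow> real) \<Rightarrow> real" where
  "expected_log_growth M T X0 X = (\<integral>\<omega>. ln (X T \<omega> / X0) \<partial>M)"

(* v is the (attained) maximum of f on S *)
definition is_maximum :: "(real \<Rightarrow> real) \<Rightarrow> real set \<Rightarrow> real \<Rightarrow> bool" where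
  "is_maximum f S v \<longleftrightarrow> (\<exists>x\<in>S. f x = v) \<and> (\<forall>x\<in>S. f x \<le> v)"

end

theory Submission
  imports Defs
begin

text \<open>For the two insiders the closed form makes \<open>ln (X T / X0)\<close> affine in \<open>W T\<close>, with mean
  \<open>r T + \<pi> ((\<mu> - r) T + \<sigma> b)\<close>, minus \<open>\<pi>\<^sup>2 \<sigma>\<^sup>2 T / 2\<close> for the forward insider. Once
  \<open>b < - (\<mu> - r) T / \<sigma>\<close> the best choice is \<open>\<pi> = 0\<close>, worth \<open>r T\<close>, which the ordinary trader
  strictly beats with a small positive \<open>\<pi>\<close>.

  The ordinary trader's wealth is given only as a solution of \<open>dX = a X dt + c X dW\<close>. It is identified
  with \<open>Y = x0 exp (a T + c W T - c\<^sup>2 T / 2)\<close> without Ito's formula, by showing \<open>E[(X T - Y)\<^sup>2] = 0\<close>: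
  the isometry and the pairing of Ito integrals with the exponential martingale turn the equation
  into linear integral equations for \<open>E[X t Y]\<close> and \<open>E[(X t)\<^sup>2]\<close>, whose values at \<open>T\<close> both come
  out as \<open>E[Y\<^sup>2]\<close>.\<close>

subsection \<open>Independence of Brownian increments from the past\<close>

text \<open>The equation for \<open>X\<close> is available only one time at a time: each
  \<open>t\<close> has its own version of the integral and its own null set, with no path continuity
  and no pointwise adaptedness. Ito's formula has nothing to act on, but L2 inner products do. The
  mixed moment with \<open>Y\<close> is easy, because the test variable \<open>Y\<close> does not
  move with \<open>t\<close>. The obstacle is E[(X t)^2]: inserting the equation once leaves
  E[X v X t] for v < t and E[I t X t], where both factors move. Both are controlled by one
  orthogonality statement: \<open>I T - I t\<close> is uncorrelated with \<open>X s\<close> for s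
  \<le> t. Adaptedness would give this by conditioning; here it comes from the isometry together
  with uniqueness for a scalar integral equation. Discounting by exp (- a t) then leaves an ODE for
  the second moment with rate a + c^2. The isometry is needed in polarised form, for integrals up to
  different times with unrelated partitions, so it is computed from the overlap lengths of pairs of
  intervals and not from a common refinement.\<close>

lemma normal_density_exp_shift:
  assumes "\<sigma> > 0"
  shows "normal_density 0 \<sigma> x * exp (c * x - c\<^sup>2 * \<sigma>\<^sup>2 / 2) = normal_density (c * \<sigma>\<^sup>2) \<sigma> x"
proof -
  \<comment> \<open>Completing the square: tilting a centred normal density by an exponential only
    moves its mean, which is Girsanov's theorem for one increment.\<close>
  have "-(x - 0)\<^sup>2 / (2 * \<sigma>\<^sup>2) + (c * x - c\<^sup>2 * \<sigma>\<^sup>2 / 2) = -(x - c * \<sigma>\<^sup>2)\<^sup>2 / (2 * \<sigma>\<^sup>2)"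
    using assms by (simp add: field_simps power2_eq_square)
  then show ?thesis
    unfolding normal_density_def by (simp add: exp_add[symmetric])
qed

locale brownian =
  fixes M :: "'a measure" and T :: real and W :: "real \<Rightarrow> 'a \<Rightarrow> real"
  assumes brownian: "brownian_motion M T W"
    and T_pos: "T > 0"
begin

sublocale prob_space M
  using brownian by (simp add: brownian_motion_def)

abbreviation "\<F> \<equiv> brownian_filtration M W"

lemma W_measurable [measurable]: "t \<in> {0..T} \<Longrightarrow> W t \<in> borel_measurable M"
  using brownian by (simp add: brownian_motion_def)

lemma W_0: "\<omega> \<in> space M \<Longrightarrow> W 0 \<omega> = 0"
  using brownian by (simp add: brownian_motion_def)

lemma increment_distributed:
  "0 \<le> s \<Longrightarrow> s < t \<Longrightarrow> t \<le> T \<Longrightarrow>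
    distributed M lborel (\<lambda>\<omega>. W t \<omega> - W s \<omega>) (normal_density 0 (sqrt (t - s)))"
  using brownian by (simp add: brownian_motion_def)

lemma space_filtration [simp]: "space (\<F> t) = space M"
  by (simp add: brownian_filtration_def space_measure_of_conv)

lemma sets_filtration:
  "sets (\<F> t) = sigma_sets (space M) {W s -` A \<inter> space M | s A. s \<in> {0..t} \<and> A \<in> sets borel}"
  unfolding brownian_filtration_def by (rule sets_measure_of) auto

lemma filtration_subset: "t \<le> T \<Longrightarrow> sets (\<F> t) \<subseteq> sets M"
  unfolding sets_filtration
  by (rule sets.sigma_sets_subset) (auto intro!: measurable_sets[OF W_measurable])

lemma filtration_mono: "s \<le> t \<Longrightarrow> sets (\<F> s) \<subseteq> sets (\<F> t)"
  unfolding sets_filtration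
proof (rule sigma_sets_mono', safe)
  fix u A assume "u \<in> {0..s}" "A \<in> sets (borel :: real measure)" "s \<le> t"
  then show "\<exists>v B. W u -` A \<inter> space M = W v -` B \<inter> space M \<and> v \<in> {0..t} \<and> B \<in> sets borel"
    by (intro exI[of _ u] exI[of _ A]) auto
qed

lemma measurable_filtrationD:
  "\<xi> \<in> borel_measurable (\<F> t) \<Longrightarrow> t \<le> T \<Longrightarrow> \<xi> \<in> borel_measurable M"
  using filtration_subset[of t] by (auto simp: measurable_def)

lemma measurable_filtration_mono:
  "\<xi> \<in> borel_measurable (\<F> s) \<Longrightarrow> s \<le> t \<Longrightarrow> \<xi> \<in> borel_measurable (\<F> t)"
  using filtration_mono[of s t] by (auto simp: measurable_def)

lemma W_adapted: "0 \<le> s \<Longrightarrow> s \<le> t \<Longrightarrow> W s \<in> borel_measurable (\<F> t)"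
  by (auto simp: measurable_def sets_filtration intro!: sigma_sets.Basic)

text \<open>Independence is given only along finite chains of times. The times in \<open>J\<close>
  are sorted into such a chain, on which each \<open>W u\<close> telescopes to a sum of increments
  before \<open>s\<close>.\<close>

lemma indep_cylinder_increment:
  assumes st: "0 \<le> s" "s < t" "t \<le> T"
    and J: "finite J" "J \<subseteq> {0..s}" and A: "\<And>u. u \<in> J \<Longrightarrow> A u \<in> sets borel"
    and B: "B \<in> sets borel"
  shows "prob ({\<omega>\<in>space M. \<forall>u\<in>J. W u \<omega> \<in> A u} \<inter> {\<omega>\<in>space M. W t \<omega> - W s \<omega> \<in> B}) =
         prob {\<omega>\<in>space M. \<forall>u\<in>J. W u \<omega> \<in> A u} * prob {\<omega>\<in>space M. W t \<omega> - W s \<omega> \<in> B}"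
proof -
  \<comment> \<open>Adding 0, where \<open>W\<close> vanishes, makes every \<open>W u\<close> a sum
    of increments; adding \<open>s\<close> makes the increment with index \<open>n\<close> exactly
    \<open>W t - W s\<close>.\<close>
  define K where "K = insert 0 (insert s J)"
  define l where "l = sorted_list_of_set K"
  define n where "n = length l - 1"
  have fK: "finite K" and K0: "K \<noteq> {}" using J by (auto simp: K_def)
  have Ksub: "K \<subseteq> {0..s}" using J st by (auto simp: K_def)
  have sl: "set l = K" "sorted l" using fK by (auto simp: l_def)
  have len: "length l = Suc n"
    using sl K0 by (cases l) (auto simp: n_def)
  define \<tau> where "\<tau> i = (if i \<le> n then l ! i else t)" for i
  have nth: "l ! i \<in> {0..s}" if "i \<le> n" for i
    using that sl Ksub len by (metis le_imp_less_Suc nth_mem subsetD)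
  have idx: "\<exists>i\<le>n. l ! i = u" if "u \<in> K" for u
    using that sl len by (metis in_set_conv_nth less_Suc_eq_le)
  have \<tau>0: "\<tau> 0 = 0"
  proof -
    obtain i where "i \<le> n" "l ! i = 0" using idx[of 0] by (auto simp: K_def)
    then have "l ! 0 \<le> 0" using sorted_nth_mono[OF sl(2), of 0 i] len by auto
    then show ?thesis using nth[of 0] by (auto simp: \<tau>_def)
  qed
  have \<tau>n: "\<tau> n = s"
  proof -
    obtain i where "i \<le> n" "l ! i = s" using idx[of s] by (auto simp: K_def)
    then have "s \<le> l ! n" using sorted_nth_mono[OF sl(2), of i n] len by auto
    then show ?thesis using nth[of n] by (auto simp: \<tau>_def)
  qed
  have \<tau>Sn: "\<tau> (Suc n) = t" by (simp add: \<tau>_def)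
  have range: "\<forall>i\<le>Suc n. \<tau> i \<in> {0..T}"
    using nth st by (force simp: \<tau>_def)
  have mono: "\<forall>i<Suc n. \<tau> i \<le> \<tau> (Suc i)"
  proof safe
    fix i assume "i < Suc n"
    show "\<tau> i \<le> \<tau> (Suc i)"
    proof (cases "i = n")
      case True
      then show ?thesis using \<tau>n \<tau>Sn st by simp
    next
      case False
      then show ?thesis using \<open>i < Suc n\<close> sorted_nth_mono[OF sl(2), of i "Suc i"] len
        by (auto simp: \<tau>_def)
    qed
  qed
  define D where "D i \<omega> = W (\<tau> (Suc i)) \<omega> - W (\<tau> i) \<omega>" for i \<omega>
  have "indep_vars (\<lambda>_. borel) D {..<Suc n}"
    using conjunct2[OF conjunct2[OF conjunct2[OF conjunct2[OF brownian[unfolded brownian_motion_def]]]], rule_format, of "Suc n" \<tau>] range mono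
    unfolding D_def by blast
  \<comment> \<open>Indices below \<open>n\<close> carry the past up to \<open>s\<close>, and index
    \<open>n\<close> alone carries the new increment.\<close>
  then have ind: "indep_var (PiM {..<n} (\<lambda>_. borel)) (\<lambda>\<omega>. restrict (\<lambda>i. D i \<omega>) {..<n})
      (PiM {n} (\<lambda>_. borel)) (\<lambda>\<omega>. restrict (\<lambda>i. D i \<omega>) {n})"
    by (rule indep_var_restrict) auto
  obtain k where k: "\<And>u. u \<in> J \<Longrightarrow> k u \<le> n \<and> l ! k u = u"
    using idx unfolding K_def by (metis insertCI)
  have Wu: "W u \<omega> = (\<Sum>i<k u. D i \<omega>)" if "u \<in> J" "\<omega> \<in> space M" for u \<omega>
  proof -
    have "(\<Sum>i<k u. D i \<omega>) = W (\<tau> (k u)) \<omega> - W (\<tau> 0) \<omega>"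
      unfolding D_def by (rule sum_lessThan_telescope)
    then show ?thesis using k[OF that(1)] that(2) \<tau>0 W_0 by (simp add: \<tau>_def)
  qed
  define S where "S = {f \<in> space (PiM {..<n} (\<lambda>_. borel :: real measure)). \<forall>u\<in>J. (\<Sum>i<k u. f i) \<in> A u}"
  have S: "S \<in> sets (PiM {..<n} (\<lambda>_. borel))"
    unfolding S_def
  proof (rule sets.sets_Collect_finite_All[OF _ J(1)])
    fix u assume 1: "u \<in> J"
    have "(\<lambda>f. \<Sum>i<k u. f i) \<in> borel_measurable (PiM {..<n} (\<lambda>_. borel :: real measure))"
      using k[OF 1] by (intro borel_measurable_sum measurable_component_singleton) auto
    from measurable_sets[OF this A[OF 1]]
    show "{f \<in> space (PiM {..<n} (\<lambda>_. borel :: real measure)). (\<Sum>i<k u. f i) \<in> A u} \<in> sets (PiM {..<n} (\<lambda>_. borel))"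
      by (simp add: vimage_def Int_def conj_commute)
  qed
  have e1: "{\<omega>\<in>space M. \<forall>u\<in>J. W u \<omega> \<in> A u} = (\<lambda>\<omega>. restrict (\<lambda>i. D i \<omega>) {..<n}) -` S \<inter> space M"
  proof -
    have "(\<Sum>i<k u. restrict (\<lambda>i. D i \<omega>) {..<n} i) = W u \<omega>" if "u \<in> J" "\<omega> \<in> space M" for u \<omega>
      unfolding Wu[OF that] using k[OF that(1)] by (intro sum.cong) auto
    then show ?thesis by (auto simp: S_def space_PiM)
  qed
  define R where "R = {f \<in> space (PiM {n} (\<lambda>_. borel :: real measure)). f n \<in> B}"
  have R: "R \<in> sets (PiM {n} (\<lambda>_. borel))"
  proof -
    have "(\<lambda>f. f n) \<in> measurable (PiM {n} (\<lambda>_. borel :: real measure)) borel"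
      by (rule measurable_component_singleton) simp
    from measurable_sets[OF this B] show ?thesis
      by (simp add: R_def vimage_def Int_def conj_commute)
  qed
  have e2: "{\<omega>\<in>space M. W t \<omega> - W s \<omega> \<in> B} = (\<lambda>\<omega>. restrict (\<lambda>i. D i \<omega>) {n}) -` R \<inter> space M"
    by (auto simp: R_def D_def \<tau>n \<tau>Sn space_PiM)
  have "prob ((\<lambda>x. (restrict (\<lambda>i. D i x) {..<n}, restrict (\<lambda>i. D i x) {n})) -` (S \<times> R) \<inter> space M) =
    prob ((\<lambda>\<omega>. restrict (\<lambda>i. D i \<omega>) {..<n}) -` S \<inter> space M) *
    prob ((\<lambda>\<omega>. restrict (\<lambda>i. D i \<omega>) {n}) -` R \<inter> space M)"
    by (rule indep_varD[OF ind S R])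
  also have "(\<lambda>x. (restrict (\<lambda>i. D i x) {..<n}, restrict (\<lambda>i. D i x) {n})) -` (S \<times> R) \<inter> space M =
     {\<omega>\<in>space M. \<forall>u\<in>J. W u \<omega> \<in> A u} \<inter> {\<omega>\<in>space M. W t \<omega> - W s \<omega> \<in> B}"
    unfolding e1 e2 by auto
  finally show ?thesis unfolding e1 e2 .
qed

text \<open>Finite-dimensional cylinders are stable under intersection and generate the past, so
  independence extends from them to the whole sigma-algebra.\<close>

lemma indep_filtration_increment:
  assumes st: "0 \<le> s" "s < t" "t \<le> T" and \<xi>: "\<xi> \<in> borel_measurable (\<F> s)"
  shows "indep_var borel \<xi> borel (\<lambda>\<omega>. W t \<omega> - W s \<omega>)"
proof -
  define G where "G = {{\<omega>\<in>space M. \<forall>u\<in>J. W u \<omega> \<in> A u} | J A.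
    finite J \<and> J \<subseteq> {0..s} \<and> (\<forall>u\<in>J. A u \<in> sets borel)}"
  define H where "H = {(\<lambda>\<omega>. W t \<omega> - W s \<omega>) -` B \<inter> space M | B. B \<in> sets borel}"
  have W: "W u \<in> borel_measurable M" if "u \<in> {0..t}" for u
    using W_measurable that st by simp
  have \<Delta>: "(\<lambda>\<omega>. W t \<omega> - W s \<omega>) \<in> borel_measurable M"
    using W st by (intro borel_measurable_diff) auto
  have GM: "G \<subseteq> events"
    unfolding G_def
  proof safe
    fix J :: "real set" and A :: "real \<Rightarrow> real set"
    assume *: "finite J" "J \<subseteq> {0..s}" "\<forall>u\<in>J. A u \<in> sets borel"
    show "{\<omega>\<in>space M. \<forall>u\<in>J. W u \<omega> \<in> A u} \<in> events"
    proof (rule sets.sets_Collect_finite_All[OF _ *(1)])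
      fix u assume 1: "u \<in> J"
      then have "W u -` A u \<inter> space M \<in> events"
        using *(2,3) W[of u] st by (intro measurable_sets[of _ _ borel]) auto
      then show "{\<omega>\<in>space M. W u \<omega> \<in> A u} \<in> events"
        by (simp add: vimage_def Int_def conj_commute)
    qed
  qed
  have HM: "H \<subseteq> events"
    using \<Delta> by (auto simp: H_def intro: measurable_sets)
  have "indep_set G H"
  proof (rule indep_setI[OF GM HM])
    fix a b assume "a \<in> G" "b \<in> H"
    then obtain J A B where *: "finite J" "J \<subseteq> {0..s}" "\<forall>u\<in>J. A u \<in> sets borel" "B \<in> sets borel"
      "a = {\<omega>\<in>space M. \<forall>u\<in>J. W u \<omega> \<in> A u}" "b = (\<lambda>\<omega>. W t \<omega> - W s \<omega>) -` B \<inter> space M"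
      unfolding G_def H_def by blast
    then have b: "b = {\<omega>\<in>space M. W t \<omega> - W s \<omega> \<in> B}" by auto
    show "prob (a \<inter> b) = prob a * prob b"
      unfolding *(5) b by (rule indep_cylinder_increment) (use st * in auto)
  qed
  moreover have "Int_stable G"
  proof (rule Int_stableI)
    fix a b assume "a \<in> G" "b \<in> G"
    then obtain J A J' A' where *: "finite J" "J \<subseteq> {0..s}" "\<forall>u\<in>J. A u \<in> sets borel"
      "finite J'" "J' \<subseteq> {0..s}" "\<forall>u\<in>J'. A' u \<in> sets borel"
      "a = {\<omega>\<in>space M. \<forall>u\<in>J. W u \<omega> \<in> A u}" "b = {\<omega>\<in>space M. \<forall>u\<in>J'. W u \<omega> \<in> A' u}"
      by (auto simp: G_def)
    \<comment> \<open>A time that is constrained in only one of the two cylinders gets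
      \<open>UNIV\<close> from the other, so that the intersection is again a cylinder.\<close>
    define C where "C u = (if u \<in> J then A u else UNIV) \<inter> (if u \<in> J' then A' u else UNIV)" for u
    have "a \<inter> b = {\<omega>\<in>space M. \<forall>u\<in>J \<union> J'. W u \<omega> \<in> C u}"
      unfolding * C_def by (auto split: if_splits)
    moreover have "\<forall>u\<in>J \<union> J'. C u \<in> sets borel"
      using * by (auto simp: C_def)
    ultimately show "a \<inter> b \<in> G"
      unfolding G_def using * by (intro CollectI exI[of _ "J \<union> J'"] exI[of _ C]) auto
  qed
  moreover have "Int_stable H"
  proof (rule Int_stableI)
    fix a b assume "a \<in> H" "b \<in> H"
    then obtain B B' where "B \<in> sets borel" "B' \<in> sets borel"
      "a = (\<lambda>\<omega>. W t \<omega> - W s \<omega>) -` B \<inter> space M" "b = (\<lambda>\<omega>. W t \<omega> - W s \<omega>) -` B' \<inter> space M"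
      by (auto simp: H_def)
    then show "a \<inter> b \<in> H"
      unfolding H_def by (intro CollectI exI[of _ "B \<inter> B'"]) auto
  qed
  ultimately have ind: "indep_set (sigma_sets (space M) G) (sigma_sets (space M) H)"
    by (rule indep_set_sigma_sets)
  have "sets (\<F> s) \<subseteq> sigma_sets (space M) G"
    unfolding sets_filtration
  proof (rule sigma_sets_mono', safe)
    fix u A assume "u \<in> {0..s}" "A \<in> sets (borel :: real measure)"
    then show "W u -` A \<inter> space M \<in> G"
      unfolding G_def by (intro CollectI exI[of _ "{u}"] exI[of _ "\<lambda>_. A"]) auto
  qed
  moreover have "sigma_sets (space M) {\<xi> -` A \<inter> space M |A. A \<in> sets borel} \<subseteq> sets (\<F> s)"
    using \<xi> sets.sigma_sets_subset[of "{\<xi> -` A \<inter> space M |A. A \<in> sets borel}" "\<F> s"]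
    by (auto simp: measurable_def)
  ultimately have sub: "sigma_sets (space M) {\<xi> -` A \<inter> space M |A. A \<in> sets borel} \<subseteq> sigma_sets (space M) G"
    by blast
  have "indep_set (sigma_sets (space M) {\<xi> -` A \<inter> space M |A. A \<in> sets borel})
     (sigma_sets (space M) {(\<lambda>\<omega>. W t \<omega> - W s \<omega>) -` A \<inter> space M |A. A \<in> sets borel})"
    using ind sub unfolding indep_sets2_eq H_def by blast
  then show ?thesis
    unfolding indep_var_eq using \<Delta> measurable_filtrationD[OF \<xi>] st by simp
qed

text \<open>The working form of independence, in place of conditional expectations. Taking for
  \<open>g\<close> the functions x, x^2, an exponential, and x times that exponential yields all the
  increment formulas below.\<close>

lemma adapted_times_increment:
  assumes st: "0 \<le> s" "s < t" "t \<le> T"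
    and Z: "Z \<in> borel_measurable (\<F> s)" "integrable M Z"
    and g: "g \<in> borel_measurable borel" "integrable lborel (\<lambda>x. normal_density 0 (sqrt (t - s)) x * g x)"
  shows "integrable M (\<lambda>\<omega>. Z \<omega> * g (W t \<omega> - W s \<omega>))" (is ?I)
    and "expectation (\<lambda>\<omega>. Z \<omega> * g (W t \<omega> - W s \<omega>)) =
      expectation Z * (\<integral>x. normal_density 0 (sqrt (t - s)) x * g x \<partial>lborel)" (is ?E)
proof -
  note d = increment_distributed[OF st]
  have ind: "indep_var borel Z borel (\<lambda>\<omega>. g (W t \<omega> - W s \<omega>))"
    using indep_var_compose[OF indep_filtration_increment[OF st Z(1)] measurable_ident g(1)]
    by (simp add: comp_def)
  have gi: "integrable M (\<lambda>\<omega>. g (W t \<omega> - W s \<omega>))"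
    using distributed_integrable[OF d, of g] g by simp
  have ge: "(\<integral>x. normal_density 0 (sqrt (t - s)) x * g x \<partial>lborel) = expectation (\<lambda>\<omega>. g (W t \<omega> - W s \<omega>))"
    using distributed_integral[OF d, of g] g by simp
  show ?I by (rule indep_var_integrable[OF ind Z(2) gi])
  show ?E unfolding ge by (rule indep_var_lebesgue_integral[OF ind Z(2) gi])
qed

lemma
  assumes st: "0 \<le> s" "s \<le> t" "t \<le> T" and Z: "Z \<in> borel_measurable (\<F> s)" "integrable M Z"
  shows integrable_adapted_increment: "integrable M (\<lambda>\<omega>. Z \<omega> * (W t \<omega> - W s \<omega>))"
    and expectation_adapted_increment: "expectation (\<lambda>\<omega>. Z \<omega> * (W t \<omega> - W s \<omega>)) = 0"
    and integrable_adapted_increment_sq: "integrable M (\<lambda>\<omega>. Z \<omega> * (W t \<omega> - W s \<omega>)\<^sup>2)"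
    and expectation_adapted_increment_sq:
      "expectation (\<lambda>\<omega>. Z \<omega> * (W t \<omega> - W s \<omega>)\<^sup>2) = (t - s) * expectation Z"
proof -
  let ?n = "normal_density 0 (sqrt (t - s))"
  have "integrable M (\<lambda>\<omega>. Z \<omega> * (W t \<omega> - W s \<omega>)) \<and> expectation (\<lambda>\<omega>. Z \<omega> * (W t \<omega> - W s \<omega>)) = 0
     \<and> integrable M (\<lambda>\<omega>. Z \<omega> * (W t \<omega> - W s \<omega>)\<^sup>2) \<and> 
      expectation (\<lambda>\<omega>. Z \<omega> * (W t \<omega> - W s \<omega>)\<^sup>2) = (t - s) * expectation Z"
  \<comment> \<open>At s = t there is no density to integrate against, and the increment is
    identically 0.\<close>
  proof (cases "s = t")
    case False
    then have st': "s < t" using st by simp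
    then have p: "0 < sqrt (t - s)" by simp
    have i: "integrable lborel (\<lambda>x. ?n x * x)" "(\<integral>x. ?n x * x \<partial>lborel) = 0"
      "integrable lborel (\<lambda>x. ?n x * x\<^sup>2)" "(\<integral>x. ?n x * x\<^sup>2 \<partial>lborel) = t - s"
      using p st' integrable_normal_moment_nz_1[OF p, of 0] integral_normal_moment_nz_1[OF p, of 0]
       integrable_normal_moment[OF p, of 0 2] integral_normal_moment_even[OF p, of 0 1]
      by (auto simp: numeral_2_eq_2)
    show ?thesis
      using adapted_times_increment[OF st(1) st' st(3) Z, of "\<lambda>x. x"]
        adapted_times_increment[OF st(1) st' st(3) Z, of "\<lambda>x. x\<^sup>2"] i by simp
  qed simp
  then show "integrable M (\<lambda>\<omega>. Z \<omega> * (W t \<omega> - W s \<omega>))"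
    "expectation (\<lambda>\<omega>. Z \<omega> * (W t \<omega> - W s \<omega>)) = 0"
    "integrable M (\<lambda>\<omega>. Z \<omega> * (W t \<omega> - W s \<omega>)\<^sup>2)"
    "expectation (\<lambda>\<omega>. Z \<omega> * (W t \<omega> - W s \<omega>)\<^sup>2) = (t - s) * expectation Z" by auto
qed

text \<open>Under the exponential weight the increment is still normal with variance
  \<open>t - s\<close>, but its mean is \<open>c * (t - s)\<close>. Total mass 1 gives the first
  expectation, the shifted mean the second.\<close>

lemma
  assumes st: "0 \<le> s" "s \<le> t" "t \<le> T" and Z: "Z \<in> borel_measurable (\<F> s)" "integrable M Z"
  shows integrable_adapted_exp_increment:
      "integrable M (\<lambda>\<omega>. Z \<omega> * exp (c * (W t \<omega> - W s \<omega>) - c\<^sup>2 * (t - s) / 2))"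
    and expectation_adapted_exp_increment:
      "expectation (\<lambda>\<omega>. Z \<omega> * exp (c * (W t \<omega> - W s \<omega>) - c\<^sup>2 * (t - s) / 2)) = expectation Z"
    and integrable_adapted_increment_exp_increment:
      "integrable M (\<lambda>\<omega>. Z \<omega> * ((W t \<omega> - W s \<omega>) * exp (c * (W t \<omega> - W s \<omega>) - c\<^sup>2 * (t - s) / 2)))"
    and expectation_adapted_increment_exp_increment:
      "expectation (\<lambda>\<omega>. Z \<omega> * ((W t \<omega> - W s \<omega>) * exp (c * (W t \<omega> - W s \<omega>) - c\<^sup>2 * (t - s) / 2)))
        = c * (t - s) * expectation Z"
proof -
  let ?n = "normal_density 0 (sqrt (t - s))"
  let ?e = "\<lambda>x. exp (c * x - c\<^sup>2 * (t - s) / 2)"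
  let ?D = "\<lambda>\<omega>. W t \<omega> - W s \<omega>"
  have "integrable M (\<lambda>\<omega>. Z \<omega> * ?e (?D \<omega>)) \<and> expectation (\<lambda>\<omega>. Z \<omega> * ?e (?D \<omega>)) = expectation Z
     \<and> integrable M (\<lambda>\<omega>. Z \<omega> * (?D \<omega> * ?e (?D \<omega>))) \<and>
      expectation (\<lambda>\<omega>. Z \<omega> * (?D \<omega> * ?e (?D \<omega>))) = c * (t - s) * expectation Z"
  proof (cases "s = t")
    case True
    then show ?thesis using Z(2) by simp
  next
    case False
    then have st': "s < t" using st by simp
    then have p: "0 < sqrt (t - s)" by simp
    have e: "?n x * ?e x = normal_density (c * (t - s)) (sqrt (t - s)) x" for x
      using normal_density_exp_shift[OF p, of x c] st' by simp
    have e': "?n x * (x * ?e x) = normal_density (c * (t - s)) (sqrt (t - s)) x * x" for x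
      using e[of x] by (metis mult.assoc mult.commute)
    have i: "integrable lborel (\<lambda>x. ?n x * ?e x)" "(\<integral>x. ?n x * ?e x \<partial>lborel) = 1"
      "integrable lborel (\<lambda>x. ?n x * (x * ?e x))" "(\<integral>x. ?n x * (x * ?e x) \<partial>lborel) = c * (t - s)"
      unfolding e e' using p
      by (auto intro: integrable_normal_moment_nz_1 integral_normal_moment_nz_1)
    show ?thesis
      using adapted_times_increment[OF st(1) st' st(3) Z, of ?e]
        adapted_times_increment[OF st(1) st' st(3) Z, of "\<lambda>x. x * ?e x"] i by simp
  qed
  then show "integrable M (\<lambda>\<omega>. Z \<omega> * ?e (?D \<omega>))" "expectation (\<lambda>\<omega>. Z \<omega> * ?e (?D \<omega>)) = expectation Z"
     "integrable M (\<lambda>\<omega>. Z \<omega> * (?D \<omega> * ?e (?D \<omega>)))"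
     "expectation (\<lambda>\<omega>. Z \<omega> * (?D \<omega> * ?e (?D \<omega>))) = c * (t - s) * expectation Z" by auto
qed

end

subsection \<open>Square-integrable functions\<close>

definition square_integrable :: "'b measure \<Rightarrow> ('b \<Rightarrow> real) \<Rightarrow> bool" where
  "square_integrable N f \<longleftrightarrow> f \<in> borel_measurable N \<and> integrable N (\<lambda>x. (f x)\<^sup>2)"

lemma square_integrable_mult_integrable:
  assumes "square_integrable N f" "square_integrable N g"
  shows "integrable N (\<lambda>x. f x * g x)"
proof (rule Bochner_Integration.integrable_bound)
  show "integrable N (\<lambda>x. (f x)\<^sup>2 + (g x)\<^sup>2)" "(\<lambda>x. f x * g x) \<in> borel_measurable N"
    using assms by (auto simp: square_integrable_def)
  have "\<bar>a * b\<bar> \<le> \<bar>a\<^sup>2 + b\<^sup>2\<bar>" for a b :: real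
  proof -
    have "0 \<le> (\<bar>a\<bar> - \<bar>b\<bar>)\<^sup>2" by simp
    then have "2 * \<bar>a * b\<bar> \<le> a\<^sup>2 + b\<^sup>2" by (simp add: power2_diff abs_mult)
    then show ?thesis by linarith
  qed
  then show "AE x in N. norm (f x * g x) \<le> norm ((f x)\<^sup>2 + (g x)\<^sup>2)" by simp
qed

lemma square_integrable_add:
  assumes "square_integrable N f" "square_integrable N g"
  shows "square_integrable N (\<lambda>x. f x + g x)"
  using square_integrable_mult_integrable[OF assms] assms
  by (auto simp: square_integrable_def power2_sum mult.assoc)

lemma square_integrable_cmult:
  "square_integrable N f \<Longrightarrow> square_integrable N (\<lambda>x. c * f x)"
  by (auto simp: square_integrable_def power_mult_distrib)

lemma square_integrable_diff:
  assumes "square_integrable N f" "square_integrable N g"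
  shows "square_integrable N (\<lambda>x. f x - g x)"
  using square_integrable_add[OF assms(1) square_integrable_cmult[OF assms(2), of "-1"]] by simp

lemma square_integrable_zero: "square_integrable N (\<lambda>_. 0)"
  by (simp add: square_integrable_def)

lemma square_integrable_sum:
  assumes "\<And>i. i \<in> I \<Longrightarrow> square_integrable N (f i)"
  shows "square_integrable N (\<lambda>x. \<Sum>i\<in>I. f i x)"
  using assms by (induction I rule: infinite_finite_induct)
    (auto intro: square_integrable_add square_integrable_zero)

lemma square_integrable_cong_AE:
  assumes "square_integrable N f" "AE x in N. f x = g x" "g \<in> borel_measurable N"
  shows "square_integrable N g"
proof -
  have "AE x in N. (f x)\<^sup>2 = (g x)\<^sup>2" using assms(2) by eventually_elim simp
  with assms show ?thesis
    using integrable_cong_AE[of "\<lambda>x. (f x)\<^sup>2" N "\<lambda>x. (g x)\<^sup>2"]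
    by (auto simp: square_integrable_def)
qed

lemma Cauchy_Schwarz_integral:
  assumes f: "square_integrable N f" and g: "square_integrable N g"
  shows "(\<integral>x. f x * g x \<partial>N)\<^sup>2 \<le> (\<integral>x. (f x)\<^sup>2 \<partial>N) * (\<integral>x. (g x)\<^sup>2 \<partial>N)"
proof -
  let ?A = "\<integral>x. (f x)\<^sup>2 \<partial>N" and ?B = "\<integral>x. f x * g x \<partial>N" and ?C = "\<integral>x. (g x)\<^sup>2 \<partial>N"
  have i: "integrable N (\<lambda>x. (f x)\<^sup>2)" "integrable N (\<lambda>x. f x * g x)" "integrable N (\<lambda>x. (g x)\<^sup>2)"
    using f g square_integrable_mult_integrable[OF f g] by (auto simp: square_integrable_def)
  have pos: "0 \<le> ?A * y\<^sup>2 + 2 * x * y * ?B + ?C * x\<^sup>2" for x y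
  proof -
    have "0 \<le> (\<integral>z. (y * f z + x * g z)\<^sup>2 \<partial>N)" by simp
    also have "(\<lambda>z. (y * f z + x * g z)\<^sup>2) = (\<lambda>z. y\<^sup>2 * (f z)\<^sup>2 + 2 * x * y * (f z * g z) + x\<^sup>2 * (g z)\<^sup>2)"
      by (simp add: fun_eq_iff power2_eq_square algebra_simps)
    also have "(\<integral>z. y\<^sup>2 * (f z)\<^sup>2 + 2 * x * y * (f z * g z) + x\<^sup>2 * (g z)\<^sup>2 \<partial>N) = y\<^sup>2 * ?A + 2 * x * y * ?B + x\<^sup>2 * ?C"
      using i by simp
    finally show ?thesis by (simp add: algebra_simps)
  qed
  have A0: "0 \<le> ?A" and C0: "0 \<le> ?C" by auto
  show ?thesis
  proof (cases "?C = 0")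
    case True
    show ?thesis
    proof (rule ccontr)
      assume "\<not> ?thesis"
      then have B: "?B \<noteq> 0" using True by auto
      \<comment> \<open>With \<open>?C = 0\<close> the form is affine in \<open>x\<close> at y = 1;
        this \<open>x\<close> gives it the value -1.\<close>
      have "0 \<le> ?A * 1\<^sup>2 + 2 * (- (?A + 1) / (2 * ?B)) * 1 * ?B + ?C * (- (?A + 1) / (2 * ?B))\<^sup>2"
        by (rule pos)
      then show False using True B A0 by (simp add: field_simps)
    qed
  next
    case False
    with C0 have "?C > 0" by linarith
    \<comment> \<open>The choice x = -\<open>?B\<close>, y = \<open>?C\<close> makes the form equal
      to \<open>?C\<close> times the difference that must be nonnegative.\<close>
    moreover have "0 \<le> ?A * ?C\<^sup>2 + 2 * (- ?B) * ?C * ?B + ?C * (- ?B)\<^sup>2" by (rule pos)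
    then have "0 \<le> ?C * (?A * ?C - ?B\<^sup>2)" by (simp add: power2_eq_square algebra_simps)
    ultimately have "0 \<le> ?A * ?C - ?B\<^sup>2" by (simp add: zero_le_mult_iff)
    then show ?thesis by simp
  qed
qed

text \<open>Square integrability is part of the notion because the Bochner integral of a
  non-integrable function is 0, which could otherwise imitate convergence.\<close>

definition L2_limit :: "'b measure \<Rightarrow> (nat \<Rightarrow> 'b \<Rightarrow> real) \<Rightarrow> ('b \<Rightarrow> real) \<Rightarrow> bool" where
  "L2_limit N F f \<longleftrightarrow> (\<forall>k. square_integrable N (F k)) \<and> square_integrable N f \<and>
     (\<lambda>k. \<integral>x. (F k x - f x)\<^sup>2 \<partial>N) \<longlonglongrightarrow> 0"

lemma L2_limit_const: "square_integrable N f \<Longrightarrow> L2_limit N (\<lambda>_. f) f"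
  by (simp add: L2_limit_def)

text \<open>Cauchy-Schwarz removes every product that contains a difference \<open>F k - f\<close>
  or \<open>G k - g\<close>. This is the one passage to the limit that carries identities from
  simple processes to Ito integrals.\<close>

lemma L2_limit_inner:
  assumes F: "L2_limit N F f" and G: "L2_limit N G g"
  shows "(\<lambda>k. \<integral>x. F k x * G k x \<partial>N) \<longlonglongrightarrow> (\<integral>x. f x * g x \<partial>N)"
proof -
  have s: "square_integrable N (F k)" "square_integrable N (G k)" "square_integrable N f" "square_integrable N g" for k
    using F G by (auto simp: L2_limit_def)
  note d = square_integrable_diff[OF s(1,3)] square_integrable_diff[OF s(2,4)]
  have to0: "(\<lambda>k. \<integral>x. a k x * b k x \<partial>N) \<longlonglongrightarrow> 0"
    if ab: "\<And>k. square_integrable N (a k)" "\<And>k. square_integrable N (b k)"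
      "(\<lambda>k. (\<integral>x. (a k x)\<^sup>2 \<partial>N) * (\<integral>x. (b k x)\<^sup>2 \<partial>N)) \<longlonglongrightarrow> 0" for a b
  proof -
    have "(\<lambda>k. (\<integral>x. a k x * b k x \<partial>N)\<^sup>2) \<longlonglongrightarrow> 0"
      by (rule tendsto_sandwich[OF _ _ tendsto_const ab(3)])
        (auto intro!: always_eventually Cauchy_Schwarz_integral ab)
    then have "(\<lambda>k. sqrt ((\<integral>x. a k x * b k x \<partial>N)\<^sup>2)) \<longlonglongrightarrow> sqrt 0"
      by (rule tendsto_real_sqrt)
    then show ?thesis by (simp add: tendsto_rabs_zero_iff)
  qed
  have F0: "(\<lambda>k. \<integral>x. (F k x - f x)\<^sup>2 \<partial>N) \<longlonglongrightarrow> 0" and G0: "(\<lambda>k. \<integral>x. (G k x - g x)\<^sup>2 \<partial>N) \<longlonglongrightarrow> 0"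
    using F G by (auto simp: L2_limit_def)
  have "(\<lambda>k. (\<integral>x. (F k x - f x) * (G k x - g x) \<partial>N) + (\<integral>x. (F k x - f x) * g x \<partial>N)
      + (\<integral>x. f x * (G k x - g x) \<partial>N) + (\<integral>x. f x * g x \<partial>N)) \<longlonglongrightarrow> 0 + 0 + 0 + (\<integral>x. f x * g x \<partial>N)"
    using tendsto_mult[OF F0 G0] tendsto_mult[OF F0 tendsto_const] tendsto_mult[OF tendsto_const G0]
    by (intro tendsto_add tendsto_const to0 s d) simp_all
  moreover have "(\<integral>x. F k x * G k x \<partial>N) = (\<integral>x. (F k x - f x) * (G k x - g x) \<partial>N) + (\<integral>x. (F k x - f x) * g x \<partial>N)
      + (\<integral>x. f x * (G k x - g x) \<partial>N) + (\<integral>x. f x * g x \<partial>N)" for k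
  proof -
    note i = square_integrable_mult_integrable[OF d(1)[of k] d(2)[of k]]
      square_integrable_mult_integrable[OF d(1)[of k] s(4)]
      square_integrable_mult_integrable[OF s(3) d(2)[of k]]
      square_integrable_mult_integrable[OF s(3,4)]
    have "(\<integral>x. F k x * G k x \<partial>N) = (\<integral>x. (F k x - f x) * (G k x - g x) + (F k x - f x) * g x
      + f x * (G k x - g x) + f x * g x \<partial>N)"
      by (rule Bochner_Integration.integral_cong) (auto simp: algebra_simps)
    also have "\<dots> = (\<integral>x. (F k x - f x) * (G k x - g x) \<partial>N) + (\<integral>x. (F k x - f x) * g x \<partial>N)
      + (\<integral>x. f x * (G k x - g x) \<partial>N) + (\<integral>x. f x * g x \<partial>N)"
      by (subst Bochner_Integration.integral_add, (intro Bochner_Integration.integrable_add i)+)+ simp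
    finally show ?thesis .
  qed
  ultimately show ?thesis by simp
qed

lemma L2_limitI_nn_integral:
  assumes f: "f \<in> borel_measurable N" and F: "\<And>k. square_integrable N (F k)"
    and lim: "(\<lambda>k. \<integral>\<^sup>+x. ennreal ((f x - F k x)\<^sup>2) \<partial>N) \<longlonglongrightarrow> 0"
  shows "L2_limit N F f"
proof -
  \<comment> \<open>Square integrability of \<open>f\<close> is not assumed. Convergence to 0 forces
    one finite distance, and f = (f - F k) + F k inherits it from there.\<close>
  have "\<exists>k. (\<integral>\<^sup>+x. ennreal ((f x - F k x)\<^sup>2) \<partial>N) < 1"
    using order_tendstoD(2)[OF lim, of 1] by (auto simp: eventually_sequentially)
  then obtain k where k: "(\<integral>\<^sup>+x. ennreal ((f x - F k x)\<^sup>2) \<partial>N) < 1" ..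
  have m: "F k \<in> borel_measurable N" for k using F by (simp add: square_integrable_def)
  have "square_integrable N (\<lambda>x. f x - F k x)"
    unfolding square_integrable_def
    using f m[of k] k by (auto intro!: integrableI_bounded simp: order.strict_trans)
  from square_integrable_add[OF this F[of k]] have sf: "square_integrable N f" by simp
  have "(\<integral>\<^sup>+x. ennreal ((f x - F k x)\<^sup>2) \<partial>N) = ennreal (\<integral>x. (F k x - f x)\<^sup>2 \<partial>N)" for k
  proof -
    have "(\<integral>\<^sup>+x. ennreal ((F k x - f x)\<^sup>2) \<partial>N) = ennreal (\<integral>x. (F k x - f x)\<^sup>2 \<partial>N)"
      using square_integrable_diff[OF F[of k] sf]
      by (intro nn_integral_eq_integral) (auto simp: square_integrable_def)
    then show ?thesis by (simp add: power2_commute)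
  qed
  then have "(\<lambda>k. ennreal (\<integral>x. (F k x - f x)\<^sup>2 \<partial>N)) \<longlonglongrightarrow> ennreal 0"
    using lim by simp
  then have "(\<lambda>k. \<integral>x. (F k x - f x)\<^sup>2 \<partial>N) \<longlonglongrightarrow> 0"
    by (subst (asm) tendsto_ennreal_iff) auto
  then show ?thesis using F sf by (simp add: L2_limit_def)
qed

subsection \<open>Inner products of weighted increments\<close>

context brownian begin

abbreviation "P \<equiv> lborel \<Otimes>\<^sub>M M"

sublocale P: pair_sigma_finite lborel M ..

text \<open>The stochastic exponential of \<open>c * W\<close>; up to the factor
  \<open>x0 * exp (a * t)\<close> it is the closed form expected for the solution.\<close>

definition exp_mart :: "real \<Rightarrow> real \<Rightarrow> 'a \<Rightarrow> real" where
  "exp_mart c t \<omega> = exp (c * W t \<omega> - c\<^sup>2 * t / 2)"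

lemma exp_mart_adapted: "0 \<le> s \<Longrightarrow> s \<le> t \<Longrightarrow> exp_mart c s \<in> borel_measurable (\<F> t)"
  unfolding exp_mart_def using W_adapted[of s t] by measurable

lemma exp_mart_step:
  "exp_mart c t \<omega> = exp_mart c s \<omega> * exp (c * (W t \<omega> - W s \<omega>) - c\<^sup>2 * (t - s) / 2)"
  unfolding exp_mart_def exp_add[symmetric] by (simp add: algebra_simps diff_divide_distrib)

lemma
  assumes "0 \<le> t" "t \<le> T"
  shows exp_mart_integrable: "integrable M (exp_mart c t)"
    and expectation_exp_mart: "expectation (exp_mart c t) = 1"
proof -
  have *: "exp_mart c t \<omega> = 1 * exp (c * (W t \<omega> - W 0 \<omega>) - c\<^sup>2 * (t - 0) / 2)" if "\<omega> \<in> space M" for \<omega>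
    using W_0[OF that] by (simp add: exp_mart_def)
  have "integrable M (\<lambda>\<omega>. 1 * exp (c * (W t \<omega> - W 0 \<omega>) - c\<^sup>2 * (t - 0) / 2))"
    by (rule integrable_adapted_exp_increment) (use assms in auto)
  then show "integrable M (exp_mart c t)"
    by (subst Bochner_Integration.integrable_cong[OF refl *])
  have "expectation (exp_mart c t) = expectation (\<lambda>\<omega>. 1 * exp (c * (W t \<omega> - W 0 \<omega>) - c\<^sup>2 * (t - 0) / 2))"
    by (rule Bochner_Integration.integral_cong[OF refl *])
  also have "\<dots> = expectation (\<lambda>\<omega>. 1)"
    by (rule expectation_adapted_exp_increment) (use assms in auto)
  finally show "expectation (exp_mart c t) = 1" by (simp add: prob_space)
qed

text \<open>Squaring doubles the parameter up to a deterministic factor, so second moments reduce to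
  the mean 1 of another exponential martingale.\<close>

lemma exp_mart_squared: "(exp_mart c t \<omega>)\<^sup>2 = exp (c\<^sup>2 * t) * exp_mart (2 * c) t \<omega>"
proof -
  have "(exp_mart c t \<omega>)\<^sup>2 = exp (2 * (c * W t \<omega> - c\<^sup>2 * t / 2))"
    unfolding exp_mart_def exp_double ..
  also have "\<dots> = exp (c\<^sup>2 * t + (2 * c * W t \<omega> - (2 * c)\<^sup>2 * t / 2))"
    by (simp add: algebra_simps power2_eq_square)
  finally show ?thesis by (simp only: exp_mart_def exp_add)
qed

lemma exp_mart_square_integrable:
  assumes "0 \<le> t" "t \<le> T"
  shows "square_integrable M (exp_mart c t)"
  unfolding square_integrable_def exp_mart_squared
  using exp_mart_integrable[OF assms, of "2 * c"] exp_mart_integrable[OF assms, of c] by auto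

lemma expectation_exp_mart_squared:
  assumes "0 \<le> t" "t \<le> T"
  shows "expectation (\<lambda>\<omega>. (exp_mart c t \<omega>)\<^sup>2) = exp (c\<^sup>2 * t)"
  unfolding exp_mart_squared using expectation_exp_mart[OF assms, of "2 * c"] by simp

text \<open>The exponential is factored at the times \<open>a\<close> and \<open>b\<close>. Its part
  after \<open>b\<close> averages to one, and its part between \<open>a\<close> and \<open>b\<close>
  gives the increment the mean \<open>c * (b - a)\<close>.\<close>

lemma increment_exp_mart_inner:
  assumes ab: "0 \<le> a" "a \<le> b" "b \<le> T" and \<xi>: "\<xi> \<in> borel_measurable (\<F> a)" "square_integrable M \<xi>"
  shows
    "expectation (\<lambda>\<omega>. (\<xi> \<omega> * (W b \<omega> - W a \<omega>)) * exp_mart c T \<omega>) =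
      c * ((b - a) * expectation (\<lambda>\<omega>. \<xi> \<omega> * exp_mart c T \<omega>))"
proof -
  let ?e = "\<lambda>s t \<omega>. exp (c * (W t \<omega> - W s \<omega>) - c\<^sup>2 * (t - s) / 2)"
  define Z where "Z \<omega> = \<xi> \<omega> * exp_mart c a \<omega>" for \<omega>
  define Y where "Y \<omega> = Z \<omega> * ((W b \<omega> - W a \<omega>) * ?e a b \<omega>)" for \<omega>
  have Z: "Z \<in> borel_measurable (\<F> a)" "integrable M Z"
    unfolding Z_def using \<xi>(1) exp_mart_adapted[of a a] ab
      square_integrable_mult_integrable[OF \<xi>(2) exp_mart_square_integrable[of a c]] by auto
  have Zb: "Z \<in> borel_measurable (\<F> b)" by (rule measurable_filtration_mono[OF Z(1) ab(2)])
  have Y: "Y \<in> borel_measurable (\<F> b)" "integrable M Y"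
    unfolding Y_def using Zb W_adapted[of a b] W_adapted[of b b] ab
      integrable_adapted_increment_exp_increment[OF ab Z, of c] by auto
  have "expectation (\<lambda>\<omega>. (\<xi> \<omega> * (W b \<omega> - W a \<omega>)) * exp_mart c T \<omega>) = expectation (\<lambda>\<omega>. Y \<omega> * ?e b T \<omega>)"
    unfolding Y_def Z_def
    by (subst exp_mart_step[of c T _ b], subst exp_mart_step[of c b _ a]) (simp add: mult.assoc mult.left_commute)
  also have "\<dots> = expectation Y"
    by (rule expectation_adapted_exp_increment[OF _ ab(3) order_refl Y]) (use ab in simp)
  also have "\<dots> = c * (b - a) * expectation Z"
    unfolding Y_def by (rule expectation_adapted_increment_exp_increment[OF ab Z])
  \<comment> \<open>The mean-one factor from \<open>a\<close> to \<open>T\<close> is put back so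
    that the test variable no longer depends on the interval; only then do the intervals of a
    partition add up to one integral.\<close>
  also have "expectation Z = expectation (\<lambda>\<omega>. Z \<omega> * ?e a T \<omega>)"
    by (rule expectation_adapted_exp_increment[OF _ _ order_refl Z, symmetric]) (use ab in auto)
  also have "\<dots> = expectation (\<lambda>\<omega>. \<xi> \<omega> * exp_mart c T \<omega>)"
    unfolding Z_def by (subst exp_mart_step[of c T _ a]) (simp add: mult.assoc)
  finally show ?thesis by (simp add: mult.assoc)
qed

lemma square_integrable_increment:
  assumes ab: "0 \<le> a" "a \<le> b" "b \<le> T" and \<xi>: "\<xi> \<in> borel_measurable (\<F> a)" "square_integrable M \<xi>"
  shows "square_integrable M (\<lambda>\<omega>. \<xi> \<omega> * (W b \<omega> - W a \<omega>))"
  using integrable_adapted_increment_sq[OF ab, of "\<lambda>\<omega>. (\<xi> \<omega>)\<^sup>2"] \<xi> W_measurable[of a] W_measurable[of b] ab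
  by (auto simp: square_integrable_def power_mult_distrib)

text \<open>The longer increment is the shorter one plus an increment after \<open>p\<close>, and
  the latter is orthogonal to everything known at \<open>p\<close>. This treats intervals with a
  common left end.\<close>

lemma
  assumes c: "0 \<le> c" "c \<le> p" "p \<le> q" "q \<le> T" and Z: "Z \<in> borel_measurable (\<F> c)" "integrable M Z"
  shows integrable_adapted_two_increments:
      "integrable M (\<lambda>\<omega>. Z \<omega> * ((W p \<omega> - W c \<omega>) * (W q \<omega> - W c \<omega>)))"
    and expectation_adapted_two_increments:
      "expectation (\<lambda>\<omega>. Z \<omega> * ((W p \<omega> - W c \<omega>) * (W q \<omega> - W c \<omega>))) = (p - c) * expectation Z"
proof -
  let ?Y = "\<lambda>\<omega>. Z \<omega> * (W p \<omega> - W c \<omega>)"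
  have cp: "p \<le> T" "0 \<le> p" using c by auto
  have Y: "?Y \<in> borel_measurable (\<F> p)" "integrable M ?Y"
    using measurable_filtration_mono[OF Z(1) c(2)] W_adapted[of c p] W_adapted[of p p] c
      integrable_adapted_increment[OF c(1,2) cp(1) Z] by auto
  have e: "(\<lambda>\<omega>. Z \<omega> * ((W p \<omega> - W c \<omega>) * (W q \<omega> - W c \<omega>))) =
    (\<lambda>\<omega>. Z \<omega> * (W p \<omega> - W c \<omega>)\<^sup>2 + ?Y \<omega> * (W q \<omega> - W p \<omega>))"
    by (simp add: fun_eq_iff power2_eq_square algebra_simps)
  note i = integrable_adapted_increment_sq[OF c(1,2) cp(1) Z] integrable_adapted_increment[OF cp(2) c(3,4) Y]
  show "integrable M (\<lambda>\<omega>. Z \<omega> * ((W p \<omega> - W c \<omega>) * (W q \<omega> - W c \<omega>)))"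
    unfolding e by (intro Bochner_Integration.integrable_add i)
  show "expectation (\<lambda>\<omega>. Z \<omega> * ((W p \<omega> - W c \<omega>) * (W q \<omega> - W c \<omega>))) = (p - c) * expectation Z"
    unfolding e Bochner_Integration.integral_add[OF i]
    using expectation_adapted_increment_sq[OF c(1,2) cp(1) Z] expectation_adapted_increment[OF cp(2) c(3,4) Y]
    by simp
qed

text \<open>Only the common part of the two intervals correlates: whichever piece of an increment
  lies after everything else averages to zero. Stating the result through the overlap length allows
  the intervals to come from unrelated partitions.\<close>

lemma increment_inner_ordered:
  assumes ab: "0 \<le> a" "a \<le> b" "b \<le> T" and \<xi>: "\<xi> \<in> borel_measurable (\<F> a)" "square_integrable M \<xi>"
    and cd: "0 \<le> c" "c \<le> d" "d \<le> T" and \<eta>: "\<eta> \<in> borel_measurable (\<F> c)" "square_integrable M \<eta>"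
    and ac: "a \<le> c"
  shows "expectation (\<lambda>\<omega>. (\<xi> \<omega> * (W b \<omega> - W a \<omega>)) * (\<eta> \<omega> * (W d \<omega> - W c \<omega>))) =
    measure lborel ({a<..b} \<inter> {c<..d}) * expectation (\<lambda>\<omega>. \<xi> \<omega> * \<eta> \<omega>)"
proof -
  have \<xi>c: "\<xi> \<in> borel_measurable (\<F> c)" by (rule measurable_filtration_mono[OF \<xi>(1) ac])
  show ?thesis
  proof (cases "b \<le> c")
    case True
    let ?Z = "\<lambda>\<omega>. (\<xi> \<omega> * (W b \<omega> - W a \<omega>)) * \<eta> \<omega>"
    have Z: "?Z \<in> borel_measurable (\<F> c)" "integrable M ?Z"
      using \<xi>c \<eta>(1) W_adapted[of a c] W_adapted[of b c] ab ac True
        square_integrable_mult_integrable[OF square_integrable_increment[OF ab \<xi>] \<eta>(2)] by auto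
    have "expectation (\<lambda>\<omega>. (\<xi> \<omega> * (W b \<omega> - W a \<omega>)) * (\<eta> \<omega> * (W d \<omega> - W c \<omega>))) =
      expectation (\<lambda>\<omega>. ?Z \<omega> * (W d \<omega> - W c \<omega>))" by (simp add: mult.assoc)
    also have "\<dots> = 0" by (rule expectation_adapted_increment[OF cd Z])
    finally have "expectation (\<lambda>\<omega>. (\<xi> \<omega> * (W b \<omega> - W a \<omega>)) * (\<eta> \<omega> * (W d \<omega> - W c \<omega>))) = 0" .
    moreover have disj: "{a<..b} \<inter> {c<..d} = {}" using True by auto
    ultimately show ?thesis unfolding disj by simp
  next
    case False
    \<comment> \<open>The overlap is the interval from \<open>c\<close> to \<open>p\<close>. Naming
      the earlier and the later right end avoids a case distinction on which interval ends
      first.\<close>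
    define p q where "p = min b d" and "q = max b d"
    have pq: "c \<le> p" "p \<le> q" "q \<le> T" using False ab cd by (auto simp: p_def q_def)
    have aT: "c \<le> T" using cd by simp
    let ?Z = "\<lambda>\<omega>. \<xi> \<omega> * \<eta> \<omega>"
    \<comment> \<open>\<open>W b - W a\<close> is cut at \<open>c\<close>: the piece
      \<open>W c - W a\<close> is known at \<open>c\<close>, so it contributes nothing against
      \<open>W d - W c\<close>.\<close>
    let ?Y = "\<lambda>\<omega>. (\<xi> \<omega> * (W c \<omega> - W a \<omega>)) * \<eta> \<omega>"
    have Z: "?Z \<in> borel_measurable (\<F> c)" "integrable M ?Z"
      using \<xi>c \<eta> square_integrable_mult_integrable[OF \<xi>(2) \<eta>(2)] by auto
    have Y: "?Y \<in> borel_measurable (\<F> c)" "integrable M ?Y"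
      using \<xi>c \<eta>(1) W_adapted[of a c] W_adapted[of c c] ab ac cd
        square_integrable_mult_integrable[OF square_integrable_increment[OF ab(1) ac aT \<xi>] \<eta>(2)] by auto
    have pq': "(W p \<omega> - W c \<omega>) * (W q \<omega> - W c \<omega>) = (W b \<omega> - W c \<omega>) * (W d \<omega> - W c \<omega>)" for \<omega>
      by (auto simp: p_def q_def min_def max_def)
    have "expectation (\<lambda>\<omega>. (\<xi> \<omega> * (W b \<omega> - W a \<omega>)) * (\<eta> \<omega> * (W d \<omega> - W c \<omega>))) =
      expectation (\<lambda>\<omega>. ?Z \<omega> * ((W p \<omega> - W c \<omega>) * (W q \<omega> - W c \<omega>)) + ?Y \<omega> * (W d \<omega> - W c \<omega>))"
      unfolding pq' by (rule Bochner_Integration.integral_cong) (auto simp: algebra_simps)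
    also have "\<dots> = (p - c) * expectation ?Z + 0"
      using integrable_adapted_two_increments[OF cd(1) pq Z] expectation_adapted_two_increments[OF cd(1) pq Z]
       integrable_adapted_increment[OF cd Y] expectation_adapted_increment[OF cd Y]
      by (subst Bochner_Integration.integral_add) simp_all
    also have "{a<..b} \<inter> {c<..d} = {c<..p}" using ac by (auto simp: p_def)
    then have "p - c = measure lborel ({a<..b} \<inter> {c<..d})" using pq by simp
    finally show ?thesis by simp
  qed
qed

lemma increment_inner:
  assumes ab: "0 \<le> a" "a \<le> b" "b \<le> T" and \<xi>: "\<xi> \<in> borel_measurable (\<F> a)" "square_integrable M \<xi>"
    and cd: "0 \<le> c" "c \<le> d" "d \<le> T" and \<eta>: "\<eta> \<in> borel_measurable (\<F> c)" "square_integrable M \<eta>"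
  shows "expectation (\<lambda>\<omega>. (\<xi> \<omega> * (W b \<omega> - W a \<omega>)) * (\<eta> \<omega> * (W d \<omega> - W c \<omega>))) =
    measure lborel ({a<..b} \<inter> {c<..d}) * expectation (\<lambda>\<omega>. \<xi> \<omega> * \<eta> \<omega>)"
proof (cases "a \<le> c")
  case True
  then show ?thesis by (rule increment_inner_ordered[OF ab \<xi> cd \<eta>])
next
  case False
  then have "c \<le> a" by simp
  from increment_inner_ordered[OF cd \<eta> ab \<xi> this] show ?thesis
    by (simp add: mult.commute Int_commute)
qed

end

section \<open>Integrals over the product of time and probability space\<close>

context brownian begin

lemma
  fixes f :: "real \<Rightarrow> real" and g :: "'a \<Rightarrow> real"
  assumes f: "integrable lborel f" and g: "integrable M g"
  shows integrable_product: "integrable P (\<lambda>x. f (fst x) * g (snd x))"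
    and integral_product: "(\<integral>x. f (fst x) * g (snd x) \<partial>P) = (\<integral>s. f s \<partial>lborel) * expectation g"
proof -
  have [measurable]: "f \<in> borel_measurable lborel" "g \<in> borel_measurable M" using f g by auto
  show i: "integrable P (\<lambda>x. f (fst x) * g (snd x))"
    by (rule P.Fubini_integrable) (use f g in \<open>auto simp: abs_mult\<close>)
  show "(\<integral>x. f (fst x) * g (snd x) \<partial>P) = (\<integral>s. f s \<partial>lborel) * expectation g"
    using P.integral_fst'[OF i] by simp
qed

lemma
  fixes Z :: "'a \<Rightarrow> real" and A :: "real set"
  assumes "integrable M Z" "A \<in> sets lborel" "emeasure lborel A < \<infinity>"
  shows integrable_strip: "integrable P (\<lambda>x. indicator A (fst x) * Z (snd x))"
    and integral_strip: "(\<integral>x. indicator A (fst x) * Z (snd x) \<partial>P) = measure lborel A * expectation Z"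
  using integrable_product[of "indicator A" Z] integral_product[of "indicator A" Z] assms
  by (auto simp: integrable_indicator_iff)

lemma square_integrable_strip:
  fixes A :: "real set"
  assumes "square_integrable M Z" "A \<in> sets lborel" "emeasure lborel A < \<infinity>"
  shows "square_integrable P (\<lambda>x. indicator A (fst x) * Z (snd x))"
proof -
  have [measurable]: "Z \<in> borel_measurable M" "A \<in> sets borel" using assms by (auto simp: square_integrable_def)
  show ?thesis
    using integrable_strip[of "\<lambda>\<omega>. (Z \<omega>)\<^sup>2" A] assms
    by (auto simp: square_integrable_def power_mult_distrib indicator_def of_bool_def if_distrib[of "\<lambda>x. x ^ 2"] cong: if_cong)
qed

lemma square_integrable_const: "square_integrable M (\<lambda>_. c)"
  by (simp add: square_integrable_def)

lemma square_integrable_integrable: "square_integrable M f \<Longrightarrow> integrable M f"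
  using square_integrable_mult_integrable[OF square_integrable_const[of 1], of f] by simp

subsection \<open>Simple processes\<close>

lemma simple_integrandD:
  assumes "simple_integrand M W t n \<tau> \<xi>" "t \<le> T" "i < n"
  shows "0 \<le> \<tau> i" "\<tau> i \<le> \<tau> (Suc i)" "\<tau> (Suc i) \<le> T" "\<xi> i \<in> borel_measurable (\<F> (\<tau> i))"
    "square_integrable M (\<xi> i)"
proof -
  have i: "i \<le> n" "Suc i \<le> n" using assms(3) by auto
  then have \<tau>: "\<tau> i \<in> {0..t}" "\<tau> (Suc i) \<in> {0..t}" using assms unfolding simple_integrand_def by blast+
  then show "0 \<le> \<tau> i" "\<tau> (Suc i) \<le> T" using assms(2) by auto
  show "\<tau> i \<le> \<tau> (Suc i)" "\<xi> i \<in> borel_measurable (\<F> (\<tau> i))"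
    using assms by (auto simp: simple_integrand_def)
  then have "\<xi> i \<in> borel_measurable M" using \<tau> assms(2) by (intro measurable_filtrationD[of _ "\<tau> i"]) auto
  then show "square_integrable M (\<xi> i)"
    using assms by (auto simp: simple_integrand_def square_integrable_def)
qed

text \<open>A function on the whole of \<open>P\<close>, so that simple processes with different
  horizons are elements of one L2 space.\<close>

definition simple_fun :: "nat \<Rightarrow> (nat \<Rightarrow> real) \<Rightarrow> (nat \<Rightarrow> 'a \<Rightarrow> real) \<Rightarrow> real \<times> 'a \<Rightarrow> real" where
  "simple_fun n \<tau> \<xi> x = simple_process n \<tau> \<xi> (fst x) (snd x)"

lemma simple_fun_eq:
  "simple_fun n \<tau> \<xi> x = (\<Sum>i<n. indicator {\<tau> i<..\<tau> (Suc i)} (fst x) * \<xi> i (snd x))"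
  by (simp add: simple_fun_def simple_process_def mult.commute)

lemma simple_fun_outside:
  assumes "simple_integrand M W t n \<tau> \<xi>" "s \<notin> {0..t}"
  shows "simple_fun n \<tau> \<xi> (s, \<omega>) = 0"
proof -
  have "s \<notin> {\<tau> i<..\<tau> (Suc i)}" if "i < n" for i
  proof -
    have "i \<le> n" "Suc i \<le> n" using that by auto
    then have "\<tau> i \<in> {0..t}" "\<tau> (Suc i) \<in> {0..t}" using assms unfolding simple_integrand_def by blast+
    then show ?thesis using assms(2) by auto
  qed
  then show ?thesis unfolding simple_fun_eq by (intro sum.neutral) auto
qed

lemma simple_integral_square_integrable:
  assumes "simple_integrand M W t n \<tau> \<xi>" "t \<le> T"
  shows "square_integrable M (simple_integral W n \<tau> \<xi>)"
  unfolding simple_integral_def using simple_integrandD[OF assms]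
  by (intro square_integrable_sum square_integrable_increment) auto

lemma simple_fun_square_integrable:
  assumes "simple_integrand M W t n \<tau> \<xi>" "t \<le> T"
  shows "square_integrable P (simple_fun n \<tau> \<xi>)"
  unfolding simple_fun_eq using simple_integrandD[OF assms]
  by (intro square_integrable_sum square_integrable_strip) auto

lemma simple_integral_mean:
  assumes "simple_integrand M W t n \<tau> \<xi>" "t \<le> T"
  shows "expectation (simple_integral W n \<tau> \<xi>) = 0"
proof -
  note d = simple_integrandD[OF assms]
  have "expectation (simple_integral W n \<tau> \<xi>) =
    (\<Sum>i<n. expectation (\<lambda>\<omega>. \<xi> i \<omega> * (W (\<tau> (Suc i)) \<omega> - W (\<tau> i) \<omega>)))"
    unfolding simple_integral_def
    using d by (intro Bochner_Integration.integral_sum integrable_adapted_increment square_integrable_integrable) auto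
  also have "\<dots> = 0"
    using d by (intro sum.neutral ballI expectation_adapted_increment square_integrable_integrable) auto
  finally show ?thesis .
qed

text \<open>Both sides expand into the same double sum: the overlap length of two intervals is also
  the time integral of the product of their indicators. The polarised form is what later compares
  \<open>I s\<close> with \<open>I t\<close>.\<close>

lemma simple_integral_inner:
  assumes 1: "simple_integrand M W t n \<tau> \<xi>" "t \<le> T" and 2: "simple_integrand M W s m \<rho> \<eta>" "s \<le> T"
  shows "expectation (\<lambda>\<omega>. simple_integral W n \<tau> \<xi> \<omega> * simple_integral W m \<rho> \<eta> \<omega>) =
    (\<integral>x. simple_fun n \<tau> \<xi> x * simple_fun m \<rho> \<eta> x \<partial>P)"
proof -
  note d1 = simple_integrandD[OF 1] and d2 = simple_integrandD[OF 2]
  let ?A = "\<lambda>i. {\<tau> i<..\<tau> (Suc i)}" and ?B = "\<lambda>j. {\<rho> j<..\<rho> (Suc j)}"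
  let ?D = "\<lambda>i \<omega>. \<xi> i \<omega> * (W (\<tau> (Suc i)) \<omega> - W (\<tau> i) \<omega>)"
  let ?E = "\<lambda>j \<omega>. \<eta> j \<omega> * (W (\<rho> (Suc j)) \<omega> - W (\<rho> j) \<omega>)"
  have si: "square_integrable M (?D i)" if "i < n" for i
    using d1[OF that] by (intro square_integrable_increment) auto
  have sj: "square_integrable M (?E j)" if "j < m" for j
    using d2[OF that] by (intro square_integrable_increment) auto
  have fin: "emeasure lborel (?A i \<inter> ?B j) < \<infinity>" for i j
    by (intro emeasure_bounded_finite bounded_Int) auto
  have I: "indicator (?A i) (fst x) * \<xi> i (snd x) * (indicator (?B j) (fst x) * \<eta> j (snd x)) =
    indicator (?A i \<inter> ?B j) (fst x) * (\<xi> i (snd x) * \<eta> j (snd x))" for i j and x :: "real \<times> 'a"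
    unfolding indicator_inter_arith by (simp only: mult.assoc mult.left_commute)
  have ip: "integrable M (\<lambda>\<omega>. \<xi> i \<omega> * \<eta> j \<omega>)" if "i < n" "j < m" for i j
    using square_integrable_mult_integrable[OF d1(5) d2(5)] that by auto
  have "expectation (\<lambda>\<omega>. simple_integral W n \<tau> \<xi> \<omega> * simple_integral W m \<rho> \<eta> \<omega>) =
     expectation (\<lambda>\<omega>. \<Sum>i<n. \<Sum>j<m. ?D i \<omega> * ?E j \<omega>)"
    by (simp add: simple_integral_def sum_product)
  also have "\<dots> = (\<Sum>i<n. expectation (\<lambda>\<omega>. \<Sum>j<m. ?D i \<omega> * ?E j \<omega>))"
    by (intro Bochner_Integration.integral_sum Bochner_Integration.integrable_sum
        square_integrable_mult_integrable si sj) auto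
  also have "\<dots> = (\<Sum>i<n. \<Sum>j<m. expectation (\<lambda>\<omega>. ?D i \<omega> * ?E j \<omega>))"
    by (intro sum.cong refl Bochner_Integration.integral_sum square_integrable_mult_integrable si sj) auto
  also have "\<dots> = (\<Sum>i<n. \<Sum>j<m. measure lborel (?A i \<inter> ?B j) * expectation (\<lambda>\<omega>. \<xi> i \<omega> * \<eta> j \<omega>))"
    by (intro sum.cong refl increment_inner) (use d1 d2 in auto)
  also have "\<dots> = (\<Sum>i<n. \<Sum>j<m. \<integral>x. indicator (?A i \<inter> ?B j) (fst x) * (\<xi> i (snd x) * \<eta> j (snd x)) \<partial>P)"
    by (intro sum.cong refl integral_strip[symmetric] ip fin) auto
  also have "\<dots> = (\<Sum>i<n. \<integral>x. (\<Sum>j<m. indicator (?A i \<inter> ?B j) (fst x) * (\<xi> i (snd x) * \<eta> j (snd x))) \<partial>P)"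
    by (intro sum.cong refl Bochner_Integration.integral_sum[symmetric] integrable_strip ip fin) auto
  also have "\<dots> = (\<integral>x. (\<Sum>i<n. \<Sum>j<m. indicator (?A i \<inter> ?B j) (fst x) * (\<xi> i (snd x) * \<eta> j (snd x))) \<partial>P)"
    by (intro Bochner_Integration.integral_sum[symmetric] Bochner_Integration.integrable_sum integrable_strip ip fin) auto
  also have "\<dots> = (\<integral>x. simple_fun n \<tau> \<xi> x * simple_fun m \<rho> \<eta> x \<partial>P)"
    unfolding simple_fun_eq sum_product I ..
  finally show ?thesis .
qed

text \<open>Constant in time and anticipating, hence a test function on \<open>P\<close> and not an
  integrand.\<close>

definition exp_strip :: "real \<Rightarrow> real \<times> 'a \<Rightarrow> real" where
  "exp_strip c x = indicator {0..T} (fst x) * exp_mart c T (snd x)"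

lemma exp_strip_square_integrable: "square_integrable P (exp_strip c)"
  unfolding exp_strip_def using T_pos by (intro square_integrable_strip exp_mart_square_integrable) auto

text \<open>The usual route writes \<open>exp_mart c T\<close> as 1 plus an Ito integral and applies
  the isometry. The tilted increments give the pairing directly, with the terminal value of the
  martingale in place of its running value.\<close>

lemma simple_integral_exp_mart:
  assumes "simple_integrand M W t n \<tau> \<xi>" "t \<le> T"
  shows "expectation (\<lambda>\<omega>. simple_integral W n \<tau> \<xi> \<omega> * exp_mart c T \<omega>) =
    c * (\<integral>x. simple_fun n \<tau> \<xi> x * exp_strip c x \<partial>P)"
proof -
  note d = simple_integrandD[OF assms]
  let ?A = "\<lambda>i. {\<tau> i<..\<tau> (Suc i)}"
  let ?D = "\<lambda>i \<omega>. \<xi> i \<omega> * (W (\<tau> (Suc i)) \<omega> - W (\<tau> i) \<omega>)"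
  have e: "square_integrable M (exp_mart c T)" using T_pos by (intro exp_mart_square_integrable) auto
  have ip: "integrable M (\<lambda>\<omega>. \<xi> i \<omega> * exp_mart c T \<omega>)" if "i < n" for i
    using square_integrable_mult_integrable[OF d(5) e] that by auto
  have I: "indicator (?A i) (fst x) * \<xi> i (snd x) * exp_strip c x =
      indicator (?A i) (fst x) * (\<xi> i (snd x) * exp_mart c T (snd x))" if "i < n" for i x
    using d(1-3)[OF that] by (auto simp: exp_strip_def indicator_def)
  have "expectation (\<lambda>\<omega>. simple_integral W n \<tau> \<xi> \<omega> * exp_mart c T \<omega>) =
     expectation (\<lambda>\<omega>. \<Sum>i<n. ?D i \<omega> * exp_mart c T \<omega>)"
    by (simp add: simple_integral_def sum_distrib_right)
  also have "\<dots> = (\<Sum>i<n. expectation (\<lambda>\<omega>. ?D i \<omega> * exp_mart c T \<omega>))"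
    using d by (intro Bochner_Integration.integral_sum square_integrable_mult_integrable e square_integrable_increment) auto
  also have "\<dots> = (\<Sum>i<n. c * (measure lborel (?A i) * expectation (\<lambda>\<omega>. \<xi> i \<omega> * exp_mart c T \<omega>)))"
    using increment_exp_mart_inner[OF d] d(2) by (intro sum.cong) auto
  also have "\<dots> = c * (\<Sum>i<n. \<integral>x. indicator (?A i) (fst x) * (\<xi> i (snd x) * exp_mart c T (snd x)) \<partial>P)"
    unfolding sum_distrib_left using d(2)
    by (intro sum.cong refl arg_cong[where f="(*) c"] integral_strip[symmetric] ip) (auto simp: emeasure_lborel_Ioc)
  also have "\<dots> = c * (\<integral>x. (\<Sum>i<n. indicator (?A i) (fst x) * (\<xi> i (snd x) * exp_mart c T (snd x))) \<partial>P)"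
    using d(2)
    by (intro arg_cong[where f="(*) c"] Bochner_Integration.integral_sum[symmetric] integrable_strip ip)
      (auto simp: emeasure_lborel_Ioc)
  also have "(\<lambda>x. \<Sum>i<n. indicator (?A i) (fst x) * (\<xi> i (snd x) * exp_mart c T (snd x))) =
     (\<lambda>x. simple_fun n \<tau> \<xi> x * exp_strip c x)"
    unfolding simple_fun_eq sum_distrib_right by (intro ext sum.cong I[symmetric]) auto
  finally show ?thesis .
qed

subsection \<open>The Ito integral\<close>

lemma strip_measurable:
  fixes f :: "real \<Rightarrow> 'a \<Rightarrow> real"
  assumes "case_prod f \<in> borel_measurable (time_interval t \<Otimes>\<^sub>M M)" "0 \<le> t"
  shows "(\<lambda>x. indicator {0..t} (fst x) * f (fst x) (snd x)) \<in> borel_measurable P"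
proof -
  \<comment> \<open>Clamping time to the interval makes the composition with \<open>f\<close> well
    typed for measurability; the indicator afterwards hides the values outside.\<close>
  have "(\<lambda>s. max 0 (min s t)) \<in> measurable lborel (time_interval t)"
    using assms(2) by (intro measurable_restrict_space2) auto
  then have "(\<lambda>x. (max 0 (min (fst x) t), snd x)) \<in> measurable P (time_interval t \<Otimes>\<^sub>M M)"
    by measurable
  from measurable_compose[OF this assms(1)]
  have "(\<lambda>x. f (max 0 (min (fst x) t)) (snd x)) \<in> borel_measurable P" by simp
  then have "(\<lambda>x. indicator {0..t} (fst x) * f (max 0 (min (fst x) t)) (snd x)) \<in> borel_measurable P"
    by measurable
  also have "(\<lambda>x. indicator {0..t} (fst x) * f (max 0 (min (fst x) t)) (snd x)) =
     (\<lambda>x. indicator {0..t} (fst x) * f (fst x) (snd x))"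
    by (auto simp: fun_eq_iff indicator_def)
  finally show ?thesis .
qed

lemma nn_integral_strip:
  assumes h [measurable]: "h \<in> borel_measurable P" and out: "\<And>s \<omega>. s \<notin> {0..t} \<Longrightarrow> h (s, \<omega>) = 0"
  shows "(\<integral>\<^sup>+x. h x \<partial>(time_interval t \<Otimes>\<^sub>M M)) = (\<integral>\<^sup>+x. h x \<partial>P)"
proof -
  have "(\<lambda>x. (fst x, snd x)) \<in> measurable (time_interval t \<Otimes>\<^sub>M M) P"
    by (intro measurable_Pair measurable_compose[OF measurable_fst] measurable_restrict_space1) auto
  from measurable_compose[OF this h] have h': "h \<in> borel_measurable (time_interval t \<Otimes>\<^sub>M M)" by simp
  have "(\<integral>\<^sup>+x. h x \<partial>(time_interval t \<Otimes>\<^sub>M M)) = (\<integral>\<^sup>+s. \<integral>\<^sup>+\<omega>. h (s, \<omega>) \<partial>M \<partial>time_interval t)"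
    by (rule nn_integral_fst[OF h', symmetric])
  also have "\<dots> = (\<integral>\<^sup>+s. (\<integral>\<^sup>+\<omega>. h (s, \<omega>) \<partial>M) * indicator {0..t} s \<partial>lborel)"
    by (rule nn_integral_restrict_space) simp
  also have "\<dots> = (\<integral>\<^sup>+s. \<integral>\<^sup>+\<omega>. h (s, \<omega>) \<partial>M \<partial>lborel)"
    using out by (intro nn_integral_cong) (auto simp: indicator_def)
  also have "\<dots> = (\<integral>\<^sup>+x. h x \<partial>P)"
    by (rule nn_integral_fst[OF h])
  finally show ?thesis .
qed

text \<open>Extension by zero, which turns integrals up to different times into inner products in
  the single space L2 of \<open>P\<close>.\<close>

definition strip :: "real \<Rightarrow> (real \<Rightarrow> 'a \<Rightarrow> real) \<Rightarrow> real \<times> 'a \<Rightarrow> real" where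
  "strip t f x = indicator {0..t} (fst x) * f (fst x) (snd x)"

lemma ito_integral_approx:
  assumes ito: "has_ito_integral M W t f I" and t: "0 \<le> t" "t \<le> T"
  obtains n \<tau> \<xi> where "\<And>k. simple_integrand M W t (n k) (\<tau> k) (\<xi> k)"
    "L2_limit M (\<lambda>k. simple_integral W (n k) (\<tau> k) (\<xi> k)) I"
    "L2_limit P (\<lambda>k. simple_fun (n k) (\<tau> k) (\<xi> k)) (strip t f)"
proof -
  obtain n \<tau> \<xi> where si: "\<And>k::nat. simple_integrand M W t (n k) (\<tau> k) (\<xi> k)"
    and l1: "(\<lambda>k::nat. \<integral>\<^sup>+(s, \<omega>). ennreal ((f s \<omega> - simple_process (n k) (\<tau> k) (\<xi> k) s \<omega>)\<^sup>2)
            \<partial>(time_interval t \<Otimes>\<^sub>M M)) \<longlonglongrightarrow> 0"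
    and l2: "(\<lambda>k. \<integral>\<^sup>+\<omega>. ennreal ((I \<omega> - simple_integral W (n k) (\<tau> k) (\<xi> k) \<omega>)\<^sup>2) \<partial>M) \<longlonglongrightarrow> 0"
    using ito unfolding has_ito_integral_def by blast
  have meas: "case_prod f \<in> borel_measurable (time_interval t \<Otimes>\<^sub>M M)" "I \<in> borel_measurable M"
    using ito unfolding has_ito_integral_def by blast+
  have sm: "strip t f \<in> borel_measurable P" unfolding strip_def by (rule strip_measurable[OF meas(1) t(1)])
  have sf: "square_integrable P (simple_fun (n k) (\<tau> k) (\<xi> k))" for k
    by (rule simple_fun_square_integrable[OF si t(2)])
  have "(\<integral>\<^sup>+(s, \<omega>). ennreal ((f s \<omega> - simple_process (n k) (\<tau> k) (\<xi> k) s \<omega>)\<^sup>2) \<partial>(time_interval t \<Otimes>\<^sub>M M)) =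
     (\<integral>\<^sup>+x. ennreal ((strip t f x - simple_fun (n k) (\<tau> k) (\<xi> k) x)\<^sup>2) \<partial>P)" for k
  proof -
    have "(\<integral>\<^sup>+(s, \<omega>). ennreal ((f s \<omega> - simple_process (n k) (\<tau> k) (\<xi> k) s \<omega>)\<^sup>2) \<partial>(time_interval t \<Otimes>\<^sub>M M)) =
      (\<integral>\<^sup>+x. ennreal ((strip t f x - simple_fun (n k) (\<tau> k) (\<xi> k) x)\<^sup>2) \<partial>(time_interval t \<Otimes>\<^sub>M M))"
      by (intro nn_integral_cong)
        (auto simp: strip_def simple_fun_def space_pair_measure space_restrict_space)
    also have "\<dots> = (\<integral>\<^sup>+x. ennreal ((strip t f x - simple_fun (n k) (\<tau> k) (\<xi> k) x)\<^sup>2) \<partial>P)"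
    proof (rule nn_integral_strip)
      show "(\<lambda>x. ennreal ((strip t f x - simple_fun (n k) (\<tau> k) (\<xi> k) x)\<^sup>2)) \<in> borel_measurable P"
        using sm sf[of k] unfolding square_integrable_def by (intro measurable_compose[OF _ measurable_ennreal] borel_measurable_power borel_measurable_diff) auto
    next
      fix s \<omega> assume "s \<notin> {0..t}"
      then show "ennreal ((strip t f (s, \<omega>) - simple_fun (n k) (\<tau> k) (\<xi> k) (s, \<omega>))\<^sup>2) = 0"
        using simple_fun_outside[OF si] by (simp add: strip_def)
    qed
    finally show ?thesis .
  qed
  with l1 have "L2_limit P (\<lambda>k. simple_fun (n k) (\<tau> k) (\<xi> k)) (strip t f)"
    by (intro L2_limitI_nn_integral sm sf) simp
  moreover have "L2_limit M (\<lambda>k. simple_integral W (n k) (\<tau> k) (\<xi> k)) I"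
    by (intro L2_limitI_nn_integral meas l2 simple_integral_square_integrable[OF si t(2)])
  ultimately show thesis using si that by blast
qed

text \<open>Mean and exponential pairing are inner products with fixed variables, \<open>1\<close>
  and \<open>exp_mart c T\<close>, so they survive the L2 limit of the simple
  approximations.\<close>

lemma
  assumes "has_ito_integral M W t f I" "0 \<le> t" "t \<le> T"
  shows ito_integral_square_integrable: "square_integrable M I"
    and ito_integral_mean: "expectation I = 0"
    and ito_integral_exp_mart:
      "expectation (\<lambda>\<omega>. I \<omega> * exp_mart c T \<omega>) = c * (\<integral>x. strip t f x * exp_strip c x \<partial>P)"
proof -
  obtain n \<tau> \<xi> where a: "\<And>k. simple_integrand M W t (n k) (\<tau> k) (\<xi> k)"
    "L2_limit M (\<lambda>k. simple_integral W (n k) (\<tau> k) (\<xi> k)) I"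
    "L2_limit P (\<lambda>k. simple_fun (n k) (\<tau> k) (\<xi> k)) (strip t f)"
    using ito_integral_approx[OF assms] by blast
  show "square_integrable M I"
    using a by (auto simp: L2_limit_def)
  have "(\<lambda>k. expectation (\<lambda>\<omega>. simple_integral W (n k) (\<tau> k) (\<xi> k) \<omega> * 1)) \<longlonglongrightarrow> expectation (\<lambda>\<omega>. I \<omega> * 1)"
    by (intro L2_limit_inner[OF a(2)] L2_limit_const square_integrable_const)
  then show "expectation I = 0"
    using simple_integral_mean[OF a(1) assms(3)] by (simp add: LIMSEQ_const_iff)
  have "(\<lambda>k. expectation (\<lambda>\<omega>. simple_integral W (n k) (\<tau> k) (\<xi> k) \<omega> * exp_mart c T \<omega>))
     \<longlonglongrightarrow> expectation (\<lambda>\<omega>. I \<omega> * exp_mart c T \<omega>)"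
    using T_pos by (intro L2_limit_inner[OF a(2)] L2_limit_const exp_mart_square_integrable) auto
  moreover have "(\<lambda>k. expectation (\<lambda>\<omega>. simple_integral W (n k) (\<tau> k) (\<xi> k) \<omega> * exp_mart c T \<omega>))
     \<longlonglongrightarrow> c * (\<integral>x. strip t f x * exp_strip c x \<partial>P)"
    unfolding simple_integral_exp_mart[OF a(1) assms(3)]
    by (intro tendsto_mult tendsto_const L2_limit_inner[OF a(3)] L2_limit_const exp_strip_square_integrable)
  ultimately show "expectation (\<lambda>\<omega>. I \<omega> * exp_mart c T \<omega>) = c * (\<integral>x. strip t f x * exp_strip c x \<partial>P)"
    by (rule LIMSEQ_unique)
qed

lemma ito_integral_inner:
  assumes 1: "has_ito_integral M W t f I" "0 \<le> t" "t \<le> T"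
    and 2: "has_ito_integral M W s g J" "0 \<le> s" "s \<le> T"
  shows "expectation (\<lambda>\<omega>. I \<omega> * J \<omega>) = (\<integral>x. strip t f x * strip s g x \<partial>P)"
proof -
  obtain n \<tau> \<xi> where a: "\<And>k. simple_integrand M W t (n k) (\<tau> k) (\<xi> k)"
    "L2_limit M (\<lambda>k. simple_integral W (n k) (\<tau> k) (\<xi> k)) I"
    "L2_limit P (\<lambda>k. simple_fun (n k) (\<tau> k) (\<xi> k)) (strip t f)"
    using ito_integral_approx[OF 1] by blast
  obtain m \<rho> \<eta> where b: "\<And>k. simple_integrand M W s (m k) (\<rho> k) (\<eta> k)"
    "L2_limit M (\<lambda>k. simple_integral W (m k) (\<rho> k) (\<eta> k)) J"
    "L2_limit P (\<lambda>k. simple_fun (m k) (\<rho> k) (\<eta> k)) (strip s g)"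
    using ito_integral_approx[OF 2] by blast
  show ?thesis
    using L2_limit_inner[OF a(2) b(2)] L2_limit_inner[OF a(3) b(3)]
    unfolding simple_integral_inner[OF a(1) 1(3) b(1) 2(3)] by (rule LIMSEQ_unique)
qed

end

subsection \<open>Linear integral equations\<close>

lemma has_real_derivative_transform:
  assumes "x \<in> S" "\<And>y. y \<in> S \<Longrightarrow> g y = f y" "(f has_real_derivative D) (at x within S)"
  shows "(g has_real_derivative D) (at x within S)"
  using has_derivative_transform[OF assms(1,2)] assms(3) by (simp add: has_field_derivative_def)

lemma continuous_on_indefinite_integral:
  fixes y :: "real \<Rightarrow> real"
  assumes "set_integrable lborel {\<alpha>..\<beta>} y"
  shows "continuous_on {\<alpha>..\<beta>} (\<lambda>t. LINT s:{\<alpha>..t}|lborel. y s)"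
proof -
  have eq: "(LINT s:{\<alpha>..t}|lborel. y s) = integral {\<alpha>..t} y" if "t \<in> {\<alpha>..\<beta>}" for t
    using that by (intro set_borel_integral_eq_integral set_integrable_subset[OF assms]) auto
  have "continuous_on {\<alpha>..\<beta>} (\<lambda>t. integral {\<alpha>..t} y)"
    by (intro indefinite_integral_continuous_1 set_borel_integral_eq_integral assms)
  then show ?thesis by (rule continuous_on_eq) (simp add: eq)
qed

lemma indefinite_integral_has_real_derivative:
  fixes y :: "real \<Rightarrow> real"
  assumes y: "continuous_on {\<alpha>..\<beta>} y" and t: "t \<in> {\<alpha>..\<beta>}"
  shows "((\<lambda>t. LINT s:{\<alpha>..t}|lborel. y s) has_real_derivative y t) (at t within {\<alpha>..\<beta>})"
proof -
  have eq: "(LINT s:{\<alpha>..t}|lborel. y s) = integral {\<alpha>..t} y" if "t \<in> {\<alpha>..\<beta>}" for t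
    using that by (intro set_borel_integral_eq_integral borel_integrable_atLeastAtMost' continuous_on_subset[OF y]) auto
  show ?thesis
    by (rule has_real_derivative_transform[OF t _ integral_has_real_derivative[OF y t]]) (simp add: eq)
qed

lemma exponential_ode_unique:
  fixes y :: "real \<Rightarrow> real"
  assumes d: "\<And>t. t \<in> {\<alpha>..\<beta>} \<Longrightarrow> (y has_real_derivative k * y t) (at t within {\<alpha>..\<beta>})"
    and t: "t \<in> {\<alpha>..\<beta>}"
  shows "y t = y \<alpha> * exp (k * (t - \<alpha>))"
proof -
  \<comment> \<open>The integrating factor turns the equation into z' = 0.\<close>
  define z where "z s = y s * exp (- k * (s - \<alpha>))" for s
  have "(z has_real_derivative 0) (at s within {\<alpha>..\<beta>})" if "s \<in> {\<alpha>..\<beta>}" for s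
    unfolding z_def by (rule derivative_eq_intros d[OF that] refl)+ (simp add: algebra_simps)
  then obtain C where C: "\<And>s. s \<in> {\<alpha>..\<beta>} \<Longrightarrow> z s = C"
    using has_field_derivative_zero_constant[of "{\<alpha>..\<beta>}" z] by auto
  have "z t = z \<alpha>" using C t by auto
  then have "y t * exp (- k * (t - \<alpha>)) = y \<alpha>" by (simp add: z_def)
  then have "y \<alpha> * exp (k * (t - \<alpha>)) = y t * (exp (- k * (t - \<alpha>)) * exp (k * (t - \<alpha>)))" by simp
  also have "exp (- k * (t - \<alpha>)) * exp (k * (t - \<alpha>)) = 1" unfolding exp_add[symmetric] by simp
  finally show ?thesis by simp
qed

text \<open>Regularity comes from the equation itself: an integrable \<open>y\<close> has a
  continuous indefinite integral, hence is continuous, hence is differentiable, and the ODE lemma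
  applies.\<close>

lemma linear_integral_equation_unique:
  fixes y :: "real \<Rightarrow> real"
  assumes y: "set_integrable lborel {\<alpha>..\<beta>} y"
    and eq: "\<And>t. t \<in> {\<alpha>..\<beta>} \<Longrightarrow> y t = y0 + k * (LINT s:{\<alpha>..t}|lborel. y s)"
    and t: "t \<in> {\<alpha>..\<beta>}"
  shows "y t = y0 * exp (k * (t - \<alpha>))"
proof -
  have "continuous_on {\<alpha>..\<beta>} (\<lambda>t. y0 + k * (LINT s:{\<alpha>..t}|lborel. y s))"
    by (intro continuous_intros continuous_on_indefinite_integral y)
  then have c: "continuous_on {\<alpha>..\<beta>} y" by (rule continuous_on_eq) (simp add: eq)
  have "(y has_real_derivative k * y s) (at s within {\<alpha>..\<beta>})" if s: "s \<in> {\<alpha>..\<beta>}" for s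
  proof (rule has_real_derivative_transform[OF s eq])
    show "((\<lambda>t. y0 + k * (LINT s:{\<alpha>..t}|lborel. y s)) has_real_derivative k * y s) (at s within {\<alpha>..\<beta>})"
      by (rule derivative_eq_intros indefinite_integral_has_real_derivative[OF c s] refl)+ simp
  qed
  then have "y t = y \<alpha> * exp (k * (t - \<alpha>))" by (rule exponential_ode_unique[OF _ t])
  moreover have "y \<alpha> = y0 + k * (LINT s:{\<alpha>..\<alpha>}|lborel. y s)" using eq[of \<alpha>] t by simp
  moreover have "(LINT s:{\<alpha>..\<alpha>}|lborel. y s) = 0" 
    using set_borel_integral_eq_integral(2)[OF set_integrable_subset[OF y, of "{\<alpha>..\<alpha>}"]] t by simp
  ultimately show ?thesis by simp
qed

subsection \<open>The linear Ito equation\<close>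

text \<open>Exactly what the ordinary wealth equation supplies, with drift rate \<open>a\<close> and
  volatility \<open>c\<close>. The quantifier over \<open>t\<close> stands outside the
  almost-everywhere statement.\<close>

locale linear_ito_equation = brownian +
  fixes X :: "real \<Rightarrow> 'a \<Rightarrow> real" and a c x0 :: real
  assumes X_sq: "integrable (time_interval T \<Otimes>\<^sub>M M) (\<lambda>(s, \<omega>). (X s \<omega>)\<^sup>2)"
    and X_meas: "case_prod X \<in> borel_measurable (time_interval T \<Otimes>\<^sub>M M)"
    and X_eq: "\<And>t. t \<in> {0..T} \<Longrightarrow> \<exists>I. has_ito_integral M W t (\<lambda>s \<omega>. c * X s \<omega>) I \<and>
        (AE \<omega> in M. X t \<omega> = x0 + (LINT s:{0..t}|lborel. a * X s \<omega>) + I \<omega>)"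
begin

text \<open>Chosen separately for every \<open>t\<close>, so no measurability in \<open>t\<close> is
  known. It is therefore only used at fixed times inside expectations and never integrated over
  time.\<close>

definition I :: "real \<Rightarrow> 'a \<Rightarrow> real" where
  "I t = (SOME J. has_ito_integral M W t (\<lambda>s \<omega>. c * X s \<omega>) J \<and>
        (AE \<omega> in M. X t \<omega> = x0 + (LINT s:{0..t}|lborel. a * X s \<omega>) + J \<omega>))"

lemma
  assumes "t \<in> {0..T}"
  shows I_ito: "has_ito_integral M W t (\<lambda>s \<omega>. c * X s \<omega>) (I t)"
    and X_AE: "AE \<omega> in M. X t \<omega> = x0 + (LINT s:{0..t}|lborel. a * X s \<omega>) + I t \<omega>"
  using someI_ex[OF X_eq[OF assms]] unfolding I_def by blast+

lemma I_square_integrable: "t \<in> {0..T} \<Longrightarrow> square_integrable M (I t)"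
  using ito_integral_square_integrable[OF I_ito] by auto

lemma X_measurable: "t \<in> {0..T} \<Longrightarrow> X t \<in> borel_measurable M"
  using measurable_compose[OF measurable_Pair1' X_meas, of t] by (simp add: space_restrict_space)

lemma strip_X_square_integrable:
  assumes "t \<in> {0..T}"
  shows "square_integrable P (strip t X)"
proof -
  have m: "strip T X \<in> borel_measurable P"
    unfolding strip_def using T_pos by (intro strip_measurable X_meas) auto
  have mt: "strip t X \<in> borel_measurable P"
  proof -
    have "(\<lambda>x. indicator {0..t} (fst x) * strip T X x) \<in> borel_measurable P"
      using m by measurable
    also have "(\<lambda>x. indicator {0..t} (fst x) * strip T X x) = strip t X"
      using assms by (auto simp: fun_eq_iff strip_def indicator_def)
    finally show ?thesis .
  qed
  have "(\<integral>\<^sup>+x. ennreal ((strip T X x)\<^sup>2) \<partial>P) = (\<integral>\<^sup>+x. ennreal ((strip T X x)\<^sup>2) \<partial>(time_interval T \<Otimes>\<^sub>M M))"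
  proof (rule nn_integral_strip[symmetric])
    show "(\<lambda>x. ennreal ((strip T X x)\<^sup>2)) \<in> borel_measurable P" using m by simp
  qed (simp add: strip_def)
  also have "\<dots> = (\<integral>\<^sup>+x. ennreal (norm (case x of (s, \<omega>) \<Rightarrow> (X s \<omega>)\<^sup>2)) \<partial>(time_interval T \<Otimes>\<^sub>M M))"
    by (intro nn_integral_cong) (auto simp: strip_def space_pair_measure space_restrict_space)
  also have "\<dots> < \<infinity>" using X_sq by (simp add: integrable_iff_bounded)
  finally have i: "integrable P (\<lambda>x. (strip T X x)\<^sup>2)"
    using m by (intro integrableI_bounded) auto
  have "integrable P (\<lambda>x. (strip t X x)\<^sup>2)"
  proof (rule Bochner_Integration.integrable_bound[OF i])
    show "(\<lambda>x. (strip t X x)\<^sup>2) \<in> borel_measurable P" using mt by simp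
    show "AE x in P. norm ((strip t X x)\<^sup>2) \<le> norm ((strip T X x)\<^sup>2)"
      using assms by (auto simp: strip_def indicator_def)
  qed
  with mt show ?thesis by (simp add: square_integrable_def)
qed

definition A :: "real \<Rightarrow> 'a \<Rightarrow> real" where
  "A t \<omega> = (\<integral>s. strip t X (s, \<omega>) \<partial>lborel)"

lemma A_eq: "(LINT s:{0..t}|lborel. X s \<omega>) = A t \<omega>"
  by (simp add: A_def strip_def set_lebesgue_integral_def)

text \<open>Cauchy-Schwarz in time against the indicator of the interval bounds the square of
  \<open>A t\<close> by \<open>t\<close> times the time integral of the squared process, which is
  integrable by Fubini.\<close>

lemma A_square_integrable:
  assumes t: "t \<in> {0..T}"
  shows "square_integrable M (A t)"
proof -
  note s = strip_X_square_integrable[OF t]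
  have sm [measurable]: "strip t X \<in> borel_measurable P" and si: "integrable P (\<lambda>x. (strip t X x)\<^sup>2)"
    using s by (auto simp: square_integrable_def)
  have [measurable]: "A t \<in> borel_measurable M" unfolding A_def by measurable
  have si': "integrable P (case_prod (\<lambda>s \<omega>. (strip t X (s, \<omega>))\<^sup>2))"
    using si by (simp add: case_prod_beta')
  have "integrable M (\<lambda>\<omega>. (A t \<omega>)\<^sup>2)"
  proof (rule Bochner_Integration.integrable_bound)
    show "integrable M (\<lambda>\<omega>. t * (\<integral>s. (strip t X (s, \<omega>))\<^sup>2 \<partial>lborel))"
      using P.integrable_snd[OF si'] by simp
    show "(\<lambda>\<omega>. (A t \<omega>)\<^sup>2) \<in> borel_measurable M" by measurable
    show "AE \<omega> in M. norm ((A t \<omega>)\<^sup>2) \<le> norm (t * (\<integral>s. (strip t X (s, \<omega>))\<^sup>2 \<partial>lborel))"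
      using P.AE_integrable_snd[OF si'] AE_space
    proof eventually_elim
      case (elim \<omega>)
      have "(\<lambda>s. strip t X (s, \<omega>)) \<in> borel_measurable lborel"
        using measurable_compose[OF measurable_Pair2'[OF elim(2)] sm] .
      then have 1: "square_integrable lborel (\<lambda>s. strip t X (s, \<omega>))"
        using elim by (simp add: square_integrable_def)
      have sq: "(\<lambda>s. (indicator {0..t} s)\<^sup>2 :: real) = indicator {0..t}"
        by (auto simp: fun_eq_iff indicator_def)
      have 2: "square_integrable lborel (indicator {0..t} :: real \<Rightarrow> real)"
        unfolding square_integrable_def sq using t by (auto intro!: integrable_real_indicator)
      have "(A t \<omega>)\<^sup>2 = (\<integral>s. strip t X (s, \<omega>) * indicator {0..t} s \<partial>lborel)\<^sup>2"
        unfolding A_def by (intro arg_cong[where f="\<lambda>x. x ^ 2"] Bochner_Integration.integral_cong) (auto simp: strip_def indicator_def)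
      also have "\<dots> \<le> (\<integral>s. (strip t X (s, \<omega>))\<^sup>2 \<partial>lborel) * (\<integral>s. (indicator {0..t} s)\<^sup>2 \<partial>lborel)"
        by (rule Cauchy_Schwarz_integral[OF 1 2])
      also note sq
      also have "(\<integral>s. indicator {0..t} s \<partial>lborel) = t" using t by simp
      finally show ?case using t by (simp add: mult.commute)
    qed
  qed
  then show ?thesis by (simp add: square_integrable_def)
qed

lemma X_AE': "t \<in> {0..T} \<Longrightarrow> AE \<omega> in M. X t \<omega> = x0 + a * A t \<omega> + I t \<omega>"
  using X_AE[of t] by (simp add: A_eq)

lemma X_square_integrable:
  assumes "t \<in> {0..T}"
  shows "square_integrable M (X t)"
proof -
  have "square_integrable M (\<lambda>\<omega>. x0 + a * A t \<omega> + I t \<omega>)"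
    by (intro square_integrable_add square_integrable_cmult A_square_integrable I_square_integrable
       square_integrable_const assms)
  moreover have "AE \<omega> in M. x0 + a * A t \<omega> + I t \<omega> = X t \<omega>"
    using X_AE'[OF assms] by eventually_elim simp
  ultimately show ?thesis
    by (rule square_integrable_cong_AE) (rule X_measurable[OF assms])
qed

text \<open>Fubini, justified because two elements of L2 of \<open>P\<close> have an integrable
  product. The first claim supplies the integrability that uniqueness of the scalar equations
  requires.\<close>

lemma
  assumes Z: "square_integrable M Z" and t: "t \<in> {0..T}"
  shows set_integrable_X_inner: "set_integrable lborel {0..t} (\<lambda>s. expectation (\<lambda>\<omega>. X s \<omega> * Z \<omega>))"
    and strip_X_inner: "(\<integral>x. strip t X x * Z (snd x) \<partial>P) = (LINT s:{0..t}|lborel. expectation (\<lambda>\<omega>. X s \<omega> * Z \<omega>))"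
    and A_inner: "expectation (\<lambda>\<omega>. A t \<omega> * Z \<omega>) = (LINT s:{0..t}|lborel. expectation (\<lambda>\<omega>. X s \<omega> * Z \<omega>))"
proof -
  have "square_integrable P (\<lambda>x. indicator {0..t} (fst x) * Z (snd x))"
    using t by (intro square_integrable_strip Z) auto
  from square_integrable_mult_integrable[OF strip_X_square_integrable[OF t] this]
  have "integrable P (\<lambda>x. strip t X x * (indicator {0..t} (fst x) * Z (snd x)))" .
  also have "(\<lambda>x. strip t X x * (indicator {0..t} (fst x) * Z (snd x))) = (\<lambda>x. strip t X x * Z (snd x))"
    by (auto simp: fun_eq_iff strip_def indicator_def)
  finally have i: "integrable P (\<lambda>x. strip t X x * Z (snd x))" .
  then have i': "integrable P (case_prod (\<lambda>s \<omega>. strip t X (s, \<omega>) * Z \<omega>))"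
    by (simp add: case_prod_beta')
  have e: "expectation (\<lambda>\<omega>. strip t X (s, \<omega>) * Z \<omega>) = indicator {0..t} s *\<^sub>R expectation (\<lambda>\<omega>. X s \<omega> * Z \<omega>)" for s
    by (simp add: strip_def mult.assoc)
  show "set_integrable lborel {0..t} (\<lambda>s. expectation (\<lambda>\<omega>. X s \<omega> * Z \<omega>))"
    using P.integrable_fst'[OF i] by (simp add: set_integrable_def e)
  show 1: "(\<integral>x. strip t X x * Z (snd x) \<partial>P) = (LINT s:{0..t}|lborel. expectation (\<lambda>\<omega>. X s \<omega> * Z \<omega>))"
    using P.integral_fst'[OF i] by (simp add: set_lebesgue_integral_def e)
  have "expectation (\<lambda>\<omega>. A t \<omega> * Z \<omega>) = expectation (\<lambda>\<omega>. \<integral>s. strip t X (s, \<omega>) * Z \<omega> \<partial>lborel)"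
    by (simp add: A_def)
  also have "\<dots> = (\<integral>x. strip t X x * Z (snd x) \<partial>P)"
    using P.integral_snd[OF i'] by (simp add: case_prod_beta')
  finally show "expectation (\<lambda>\<omega>. A t \<omega> * Z \<omega>) = (LINT s:{0..t}|lborel. expectation (\<lambda>\<omega>. X s \<omega> * Z \<omega>))"
    using 1 by simp
qed

text \<open>Testing the equation against a fixed \<open>Z\<close> leaves a scalar integral equation
  whose only unknown remainder is the pairing of \<open>I t\<close> with \<open>Z\<close>. Each
  moment below results from one choice of \<open>Z\<close>.\<close>

lemma X_inner:
  assumes Z: "square_integrable M Z" and t: "t \<in> {0..T}"
  shows "expectation (\<lambda>\<omega>. X t \<omega> * Z \<omega>) = x0 * expectation Z +
    a * (LINT s:{0..t}|lborel. expectation (\<lambda>\<omega>. X s \<omega> * Z \<omega>)) + expectation (\<lambda>\<omega>. I t \<omega> * Z \<omega>)"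
proof -
  have i: "integrable M Z" "integrable M (\<lambda>\<omega>. A t \<omega> * Z \<omega>)" "integrable M (\<lambda>\<omega>. I t \<omega> * Z \<omega>)"
    by (intro square_integrable_integrable square_integrable_mult_integrable A_square_integrable
      I_square_integrable Z t)+
  have "expectation (\<lambda>\<omega>. X t \<omega> * Z \<omega>) = expectation (\<lambda>\<omega>. x0 * Z \<omega> + a * (A t \<omega> * Z \<omega>) + I t \<omega> * Z \<omega>)"
  proof (rule integral_cong_AE)
    show "AE \<omega> in M. X t \<omega> * Z \<omega> = x0 * Z \<omega> + a * (A t \<omega> * Z \<omega>) + I t \<omega> * Z \<omega>"
      using X_AE'[OF t] by eventually_elim (simp add: algebra_simps)
    show "(\<lambda>\<omega>. X t \<omega> * Z \<omega>) \<in> borel_measurable M"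
      using X_measurable[OF t] i(1) by auto
    show "(\<lambda>\<omega>. x0 * Z \<omega> + a * (A t \<omega> * Z \<omega>) + I t \<omega> * Z \<omega>) \<in> borel_measurable M"
      using i by auto
  qed
  also have "\<dots> = x0 * expectation Z + a * expectation (\<lambda>\<omega>. A t \<omega> * Z \<omega>) + expectation (\<lambda>\<omega>. I t \<omega> * Z \<omega>)"
    using i by simp
  finally show ?thesis unfolding A_inner[OF Z t] .
qed

section \<open>Moments of the solution\<close>

definition u :: "real \<Rightarrow> real" where "u t = expectation (\<lambda>\<omega>. (X t \<omega>)\<^sup>2)"

lemma
  assumes "t \<in> {0..T}"
  shows set_integrable_u: "set_integrable lborel {0..t} u"
    and integral_strip_X_sq: "(\<integral>x. (strip t X x)\<^sup>2 \<partial>P) = (LINT s:{0..t}|lborel. u s)"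
proof -
  have i: "integrable P (\<lambda>x. (strip t X x)\<^sup>2)"
    using strip_X_square_integrable[OF assms] by (simp add: square_integrable_def)
  have e: "expectation (\<lambda>\<omega>. (strip t X (s, \<omega>))\<^sup>2) = indicator {0..t} s *\<^sub>R u s" for s
    by (auto simp: strip_def u_def indicator_def)
  show "set_integrable lborel {0..t} u"
    using P.integrable_fst'[OF i] by (simp add: set_integrable_def e)
  show "(\<integral>x. (strip t X x)\<^sup>2 \<partial>P) = (LINT s:{0..t}|lborel. u s)"
    using P.integral_fst'[OF i] by (simp add: set_lebesgue_integral_def e)
qed

lemma I_inner:
  assumes "s \<in> {0..T}" "t \<in> {0..T}" "s \<le> t"
  shows "expectation (\<lambda>\<omega>. I s \<omega> * I t \<omega>) = c\<^sup>2 * (LINT v:{0..s}|lborel. u v)"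
proof -
  have "expectation (\<lambda>\<omega>. I s \<omega> * I t \<omega>) =
     (\<integral>x. strip s (\<lambda>s \<omega>. c * X s \<omega>) x * strip t (\<lambda>s \<omega>. c * X s \<omega>) x \<partial>P)"
    by (rule ito_integral_inner[OF I_ito _ _ I_ito]) (use assms in auto)
  also have "\<dots> = (\<integral>x. c\<^sup>2 * (strip s X x)\<^sup>2 \<partial>P)"
    using assms by (intro Bochner_Integration.integral_cong) (auto simp: strip_def indicator_def power2_eq_square)
  finally show ?thesis by (simp add: integral_strip_X_sq[OF assms(1)])
qed

text \<open>One factor \<open>c\<close> comes from the integrand and one from the tilted increments.
  Their product is what raises the growth rate of the pairing with \<open>exp_mart c T\<close> from
  \<open>a\<close> to a + c^2.\<close>

lemma I_exp_mart:
  assumes "t \<in> {0..T}"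
  shows "expectation (\<lambda>\<omega>. I t \<omega> * exp_mart c T \<omega>) =
    c\<^sup>2 * (LINT s:{0..t}|lborel. expectation (\<lambda>\<omega>. X s \<omega> * exp_mart c T \<omega>))"
proof -
  have "expectation (\<lambda>\<omega>. I t \<omega> * exp_mart c T \<omega>) = c * (\<integral>x. strip t (\<lambda>s \<omega>. c * X s \<omega>) x * exp_strip c x \<partial>P)"
    by (rule ito_integral_exp_mart[OF I_ito]) (use assms in auto)
  also have "(\<integral>x. strip t (\<lambda>s \<omega>. c * X s \<omega>) x * exp_strip c x \<partial>P) = (\<integral>x. c * (strip t X x * exp_mart c T (snd x)) \<partial>P)"
    using assms by (intro Bochner_Integration.integral_cong) (auto simp: strip_def exp_strip_def indicator_def)
  also have "\<dots> = c * (LINT s:{0..t}|lborel. expectation (\<lambda>\<omega>. X s \<omega> * exp_mart c T \<omega>))"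
    using T_pos assms by (simp add: strip_X_inner exp_mart_square_integrable)
  finally show ?thesis by (simp add: power2_eq_square)
qed

lemma expectation_X_exp_mart:
  "expectation (\<lambda>\<omega>. X T \<omega> * exp_mart c T \<omega>) = x0 * exp ((a + c\<^sup>2) * T)"
proof -
  have e: "square_integrable M (exp_mart c T)" using T_pos by (intro exp_mart_square_integrable) auto
  have "expectation (\<lambda>\<omega>. X T \<omega> * exp_mart c T \<omega>) = x0 * exp ((a + c\<^sup>2) * (T - 0))"
  proof (rule linear_integral_equation_unique[where \<beta>=T
      and y="\<lambda>t. expectation (\<lambda>\<omega>. X t \<omega> * exp_mart c T \<omega>)"])
    show "set_integrable lborel {0..T} (\<lambda>s. expectation (\<lambda>\<omega>. X s \<omega> * exp_mart c T \<omega>))"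
      using T_pos by (intro set_integrable_X_inner e) auto
    show "expectation (\<lambda>\<omega>. X t \<omega> * exp_mart c T \<omega>) = x0 + (a + c\<^sup>2) *
       (LINT s:{0..t}|lborel. expectation (\<lambda>\<omega>. X s \<omega> * exp_mart c T \<omega>))" if t: "t \<in> {0..T}" for t
      using X_inner[OF e t] I_exp_mart[OF t] expectation_exp_mart[of T c] T_pos by (simp add: algebra_simps)
  qed (use T_pos in auto)
  then show ?thesis by simp
qed

lemma expectation_X:
  assumes "t \<in> {0..T}"
  shows "expectation (X t) = x0 * exp (a * t)"
proof -
  have "expectation (\<lambda>\<omega>. X t \<omega> * 1) = x0 * exp (a * (t - 0))"
  proof (rule linear_integral_equation_unique[where \<beta>=T])
    show "set_integrable lborel {0..T} (\<lambda>s. expectation (\<lambda>\<omega>. X s \<omega> * 1))"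
      using T_pos by (intro set_integrable_X_inner square_integrable_const) auto
    show "expectation (\<lambda>\<omega>. X t \<omega> * 1) = x0 + a * (LINT s:{0..t}|lborel. expectation (\<lambda>\<omega>. X s \<omega> * 1))"
      if t: "t \<in> {0..T}" for t
      using X_inner[OF square_integrable_const t, of 1] ito_integral_mean[OF I_ito[OF t]] t by (simp add: prob_space)
  qed (use assms in auto)
  then show ?thesis by simp
qed

text \<open>This replaces the martingale property: the map \<open>s \<mapsto> E[X s (I T - I t)]\<close> solves a homogeneous
  linear integral equation on \<open>[0,t]\<close>, because the Ito isometry makes \<open>I T - I t\<close> orthogonal to \<open>I s\<close>.\<close>

lemma X_I_increment_orthogonal:
  assumes "s \<in> {0..t}" "t \<in> {0..T}"
  shows "expectation (\<lambda>\<omega>. X s \<omega> * I T \<omega>) = expectation (\<lambda>\<omega>. X s \<omega> * I t \<omega>)"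
proof -
  have T: "T \<in> {0..T}" and s: "s \<in> {0..T}" using T_pos assms by auto
  note sq = I_square_integrable[OF T] I_square_integrable[OF assms(2)]
  let ?Z = "\<lambda>\<omega>. I T \<omega> - I t \<omega>"
  have Z: "square_integrable M ?Z" by (intro square_integrable_diff sq)
  have "expectation (\<lambda>\<omega>. X s \<omega> * ?Z \<omega>) = 0 * exp (a * (s - 0))"
  proof (rule linear_integral_equation_unique[where \<beta>=t])
    show "set_integrable lborel {0..t} (\<lambda>s. expectation (\<lambda>\<omega>. X s \<omega> * ?Z \<omega>))"
      by (intro set_integrable_X_inner Z assms)
    show "expectation (\<lambda>\<omega>. X r \<omega> * ?Z \<omega>) = 0 + a * (LINT s:{0..r}|lborel. expectation (\<lambda>\<omega>. X s \<omega> * ?Z \<omega>))"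
      if r: "r \<in> {0..t}" for r
    proof -
      have r': "r \<in> {0..T}" using r assms by auto
      have "expectation ?Z = 0"
        using sq[THEN square_integrable_integrable] ito_integral_mean[OF I_ito[OF T]]
          ito_integral_mean[OF I_ito[OF assms(2)]] T assms by simp
      moreover have "expectation (\<lambda>\<omega>. I r \<omega> * ?Z \<omega>) = expectation (\<lambda>\<omega>. I r \<omega> * I T \<omega>) - expectation (\<lambda>\<omega>. I r \<omega> * I t \<omega>)"
        unfolding right_diff_distrib
        by (intro Bochner_Integration.integral_diff square_integrable_mult_integrable sq I_square_integrable r')
      then have "expectation (\<lambda>\<omega>. I r \<omega> * ?Z \<omega>) = 0"
        using I_inner[OF r' T] I_inner[OF r' assms(2)] r r' by simp
      ultimately show ?thesis using X_inner[OF Z r'] by simp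
    qed
  qed (use assms in auto)
  moreover have "expectation (\<lambda>\<omega>. X s \<omega> * ?Z \<omega>) = expectation (\<lambda>\<omega>. X s \<omega> * I T \<omega>) - expectation (\<lambda>\<omega>. X s \<omega> * I t \<omega>)"
    unfolding right_diff_distrib
    by (intro Bochner_Integration.integral_diff square_integrable_mult_integrable sq X_square_integrable s)
  ultimately show ?thesis by simp
qed

text \<open>After time \<open>s\<close> the stochastic integral no longer contributes to the pairing
  with \<open>X s\<close>, so only the drift acts and the pairing grows at rate \<open>a\<close>
  from its value \<open>u s\<close>.\<close>

lemma X_inner_X:
  assumes st: "s \<in> {0..T}" "t \<in> {s..T}"
  shows "expectation (\<lambda>\<omega>. X t \<omega> * X s \<omega>) = u s * exp (a * (t - s))"
proof -
  note Xs = X_square_integrable[OF st(1)]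
  let ?y = "\<lambda>v. expectation (\<lambda>\<omega>. X v \<omega> * X s \<omega>)"
  have T: "T \<in> {0..T}" using T_pos by simp
  have int: "set_integrable lborel {0..T} ?y" by (rule set_integrable_X_inner[OF Xs T])
  have us: "?y s = u s" by (simp add: u_def power2_eq_square)
  have split: "(LINT v:{0..r}|lborel. ?y v) = (LINT v:{0..s}|lborel. ?y v) + (LINT v:{s..r}|lborel. ?y v)"
    if r: "r \<in> {s..T}" for r
  proof -
    have *: "set_integrable lborel {0..r} ?y" using r by (intro set_integrable_subset[OF int]) auto
    have "(LINT v:{0..r}|lborel. ?y v) = integral {0..r} ?y"
      "(LINT v:{0..s}|lborel. ?y v) = integral {0..s} ?y"
      "(LINT v:{s..r}|lborel. ?y v) = integral {s..r} ?y"
      using r st(1) by (intro set_borel_integral_eq_integral set_integrable_subset[OF int]; auto)+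
    moreover have "integral {0..s} ?y + integral {s..r} ?y = integral {0..r} ?y"
      using r st(1) by (intro Henstock_Kurzweil_Integration.integral_combine set_borel_integral_eq_integral(1)[OF *]) auto
    ultimately show ?thesis by simp
  qed
  \<comment> \<open>Both sides equal the pairing of \<open>X s\<close> with \<open>I T\<close>, by
    orthogonality of the later increments of the integral.\<close>
  have IX: "expectation (\<lambda>\<omega>. I r \<omega> * X s \<omega>) = expectation (\<lambda>\<omega>. I s \<omega> * X s \<omega>)" if r: "r \<in> {s..T}" for r
    using X_I_increment_orthogonal[of s r] X_I_increment_orthogonal[of s s] r st(1) by (simp add: mult.commute)
  show ?thesis
  proof (rule linear_integral_equation_unique[where \<beta>=T])
    show "set_integrable lborel {s..T} ?y" using st(1) by (intro set_integrable_subset[OF int]) auto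
    show "?y r = u s + a * (LINT v:{s..r}|lborel. ?y v)" if r: "r \<in> {s..T}" for r
    proof -
      have r': "r \<in> {0..T}" using r st(1) by auto
      show ?thesis
        using X_inner[OF Xs r'] X_inner[OF Xs st(1)] split[OF r] IX[OF r] us by (simp add: algebra_simps)
    qed
  qed (rule st(2))
qed

text \<open>Testing the equation against \<open>X t\<close> puts E[X v X t] = u v exp (a (t - v))
  under the time integral. This kernel depends on both times; discounting by exp (- a t) makes it an
  ordinary indefinite integral.\<close>

lemma second_moment: "u T = x0\<^sup>2 * exp ((2 * a + c\<^sup>2) * T)"
proof -
  have T: "T \<in> {0..T}" using T_pos by simp
  \<comment> \<open>The pairing needed is that of \<open>X t\<close> with \<open>I t\<close>.
    Orthogonality allows \<open>I T\<close> instead, a test variable independent of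
    \<open>t\<close>, so that \<open>w\<close> satisfies an integral equation of its own.\<close>
  define w where "w t = expectation (\<lambda>\<omega>. X t \<omega> * I T \<omega>)" for t
  define m where "m t = exp (- a * t) * u t" for t
    \<comment> \<open>\<open>m = x0\<^sup>2 + a \<integral>m + n\<close> with \<open>n t = exp (- a t) * w t\<close> and \<open>n' = c\<^sup>2 m\<close>, hence \<open>m' = (a + c\<^sup>2) m\<close>\<close>
  note IT = I_square_integrable[OF T]
  have wint: "set_integrable lborel {0..T} w"
    unfolding w_def by (rule set_integrable_X_inner[OF IT T])
  have w: "w t = a * (LINT s:{0..t}|lborel. w s) + c\<^sup>2 * (LINT s:{0..t}|lborel. u s)" if t: "t \<in> {0..T}" for t
    using X_inner[OF IT t] I_inner[OF t T] ito_integral_mean[OF I_ito[OF T]] T t by (simp add: w_def)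
  have uw: "u t = exp (a * t) * (x0\<^sup>2 + a * (LINT s:{0..t}|lborel. m s)) + w t" if t: "t \<in> {0..T}" for t
  proof -
    have "u t = x0 * expectation (X t) + a * (LINT v:{0..t}|lborel. expectation (\<lambda>\<omega>. X v \<omega> * X t \<omega>)) + expectation (\<lambda>\<omega>. I t \<omega> * X t \<omega>)"
      using X_inner[OF X_square_integrable[OF t] t] by (simp add: u_def power2_eq_square)
    also have "(LINT v:{0..t}|lborel. expectation (\<lambda>\<omega>. X v \<omega> * X t \<omega>)) = (LINT v:{0..t}|lborel. exp (a * t) * m v)"
    proof (rule set_lebesgue_integral_cong, simp, safe)
      fix v assume v: "v \<in> {0..t}"
      have "expectation (\<lambda>\<omega>. X v \<omega> * X t \<omega>) = expectation (\<lambda>\<omega>. X t \<omega> * X v \<omega>)" by (simp add: mult.commute)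
      also have "\<dots> = u v * exp (a * (t - v))" by (rule X_inner_X) (use v t in auto)
      also have "\<dots> = exp (a * t) * m v"
        by (simp add: m_def exp_diff exp_minus field_simps right_diff_distrib)
      finally show "expectation (\<lambda>\<omega>. X v \<omega> * X t \<omega>) = exp (a * t) * m v" .
    qed
    also have "\<dots> = exp (a * t) * (LINT v:{0..t}|lborel. m v)" by simp
    also have "expectation (\<lambda>\<omega>. I t \<omega> * X t \<omega>) = w t"
      using X_I_increment_orthogonal[of t t] t by (simp add: w_def mult.commute)
    finally show ?thesis using expectation_X[OF t] by (simp add: algebra_simps power2_eq_square)
  qed
  have uint: "set_integrable lborel {0..T} u" by (rule set_integrable_u[OF T])
  \<comment> \<open>Continuity of \<open>u\<close> is not known yet, so \<open>m\<close> is
    dominated by a constant multiple of the integrable \<open>u\<close>.\<close>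
  have mint: "set_integrable lborel {0..T} m"
  proof -
    have um: "(\<lambda>s. indicator {0..T} s *\<^sub>R u s) \<in> borel_measurable lborel"
      using uint by (auto simp: set_integrable_def)
    show ?thesis
    proof (rule set_integrable_bound)
      show "set_integrable lborel {0..T} (\<lambda>t. exp (\<bar>a\<bar> * T) * u t)"
        using uint by simp
      have "(\<lambda>s. exp (- a * s) * (indicator {0..T} s *\<^sub>R u s)) \<in> borel_measurable lborel"
        using um by measurable
      then show "set_borel_measurable lborel {0..T} m"
        by (simp add: set_borel_measurable_def m_def mult.left_commute)
      have "exp (- a * t) \<le> exp (\<bar>a\<bar> * T)" if "t \<in> {0..T}" for t
      proof -
        have "- a * t \<le> \<bar>a\<bar> * t" using that by (intro mult_right_mono) auto
        also have "\<dots> \<le> \<bar>a\<bar> * T" using that by (intro mult_left_mono) auto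
        finally show ?thesis by simp
      qed
      then show "AE t in lborel. t \<in> {0..T} \<longrightarrow> norm (m t) \<le> norm (exp (\<bar>a\<bar> * T) * u t)"
        by (auto simp: m_def abs_mult intro!: mult_right_mono)
    qed
  qed
  \<comment> \<open>Continuity is gained in the order \<open>w\<close>, \<open>u\<close>,
    \<open>m\<close>: the first two from their expressions through indefinite integrals,
    \<open>m\<close> from \<open>u\<close>. It is needed before these integrals can be
    differentiated.\<close>
  have "continuous_on {0..T} (\<lambda>t. a * (LINT s:{0..t}|lborel. w s) + c\<^sup>2 * (LINT s:{0..t}|lborel. u s))"
    by (intro continuous_intros continuous_on_indefinite_integral wint uint)
  then have wc: "continuous_on {0..T} w" by (rule continuous_on_eq) (simp add: w)
  have "continuous_on {0..T} (\<lambda>t. exp (a * t) * (x0\<^sup>2 + a * (LINT s:{0..t}|lborel. m s)) + w t)"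
    by (intro continuous_intros continuous_on_indefinite_integral mint wc)
  then have uc: "continuous_on {0..T} u" by (rule continuous_on_eq) (simp add: uw)
  have mc: "continuous_on {0..T} m" unfolding m_def by (intro continuous_intros uc)
  have m: "m t = x0\<^sup>2 + a * (LINT s:{0..t}|lborel. m s) + exp (- a * t) * w t" if "t \<in> {0..T}" for t
    unfolding m_def[of t] uw[OF that] distrib_left mult.assoc[symmetric] exp_add[symmetric] by simp
  have wd: "(w has_real_derivative a * w t + c\<^sup>2 * u t) (at t within {0..T})" if t: "t \<in> {0..T}" for t
  proof (rule has_real_derivative_transform[OF t w])
    show "((\<lambda>t. a * (LINT s:{0..t}|lborel. w s) + c\<^sup>2 * (LINT s:{0..t}|lborel. u s)) has_real_derivative
       a * w t + c\<^sup>2 * u t) (at t within {0..T})"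
      by (rule derivative_eq_intros indefinite_integral_has_real_derivative[OF wc t]
        indefinite_integral_has_real_derivative[OF uc t] refl)+ simp
  qed
  have md: "(m has_real_derivative (a + c\<^sup>2) * m t) (at t within {0..T})" if t: "t \<in> {0..T}" for t
  proof (rule has_real_derivative_transform[OF t m])
    show "((\<lambda>t. x0\<^sup>2 + a * (LINT s:{0..t}|lborel. m s) + exp (- a * t) * w t) has_real_derivative
       (a + c\<^sup>2) * m t) (at t within {0..T})"
      by (rule derivative_eq_intros indefinite_integral_has_real_derivative[OF mc t] wd[OF t] refl)+
        (simp add: m_def algebra_simps)
  qed
  have zero: "(LINT s:{0..0}|lborel. f s) = 0" if "set_integrable lborel {0..T} f" for f :: "real \<Rightarrow> real"
    using set_borel_integral_eq_integral(2)[OF set_integrable_subset[OF that, of "{0..0}"]] T_pos by simp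
  have w0: "w 0 = 0" using w[of 0] T_pos zero[OF wint] zero[OF uint] by simp
  have m0: "m 0 = x0\<^sup>2" using m[of 0] T_pos zero[OF mint] w0 by simp
  have "m T = m 0 * exp ((a + c\<^sup>2) * (T - 0))" by (rule exponential_ode_unique[OF md T])
  then have "exp (a * T) * m T = x0\<^sup>2 * (exp (a * T) * exp ((a + c\<^sup>2) * T))" using m0 by simp
  also have "exp (a * T) * exp ((a + c\<^sup>2) * T) = exp ((2 * a + c\<^sup>2) * T)"
    unfolding exp_add[symmetric] by (simp add: algebra_simps)
  also have "exp (a * T) * m T = u T"
    unfolding m_def mult.assoc[symmetric] exp_add[symmetric] by simp
  finally show ?thesis .
qed

theorem X_T_eq: "AE \<omega> in M. X T \<omega> = x0 * exp (a * T) * exp_mart c T \<omega>"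
proof -
  have T: "T \<in> {0..T}" using T_pos by simp
  define k where "k = x0 * exp (a * T)"
  have X: "square_integrable M (X T)" by (rule X_square_integrable[OF T])
  have E: "square_integrable M (exp_mart c T)" using T_pos by (intro exp_mart_square_integrable) auto
  have D: "square_integrable M (\<lambda>\<omega>. X T \<omega> - k * exp_mart c T \<omega>)"
    by (intro square_integrable_diff square_integrable_cmult X E)
  have i: "integrable M (\<lambda>\<omega>. (X T \<omega>)\<^sup>2)" "integrable M (\<lambda>\<omega>. X T \<omega> * exp_mart c T \<omega>)"
    "integrable M (\<lambda>\<omega>. (exp_mart c T \<omega>)\<^sup>2)"
    using X E square_integrable_mult_integrable[OF X E] by (auto simp: square_integrable_def)
  have "expectation (\<lambda>\<omega>. (X T \<omega> - k * exp_mart c T \<omega>)\<^sup>2) =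
    expectation (\<lambda>\<omega>. (X T \<omega>)\<^sup>2 - (2 * k) * (X T \<omega> * exp_mart c T \<omega>) + k\<^sup>2 * (exp_mart c T \<omega>)\<^sup>2)"
    by (intro Bochner_Integration.integral_cong) (auto simp: power2_diff power_mult_distrib)
  also have "\<dots> = u T - (2 * k) * (x0 * exp ((a + c\<^sup>2) * T)) + k\<^sup>2 * exp (c\<^sup>2 * T)"
    using i T_pos by (simp add: u_def expectation_X_exp_mart expectation_exp_mart_squared)
  \<comment> \<open>The three terms are 1, -2 and 1 times
    \<open>x0^2 * exp ((2 * a + c^2) * T)\<close>.\<close>
  also have "\<dots> = 0"
  proof -
    have "exp ((2 * a + c\<^sup>2) * T) = exp (a * T) * exp (a * T) * exp (c\<^sup>2 * T)"
      "exp ((a + c\<^sup>2) * T) = exp (a * T) * exp (c\<^sup>2 * T)"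
      unfolding exp_add[symmetric] by (simp_all add: algebra_simps)
    then show ?thesis unfolding second_moment k_def by (simp add: power2_eq_square)
  qed
  finally have "AE \<omega> in M. (X T \<omega> - k * exp_mart c T \<omega>)\<^sup>2 = 0"
    using D by (subst integral_nonneg_eq_0_iff_AE[symmetric]) (auto simp: square_integrable_def)
  then show ?thesis by eventually_elim (simp add: k_def)
qed

end

subsection \<open>Expected logarithmic growth\<close>

context brownian begin

lemma W_T_integrable: "integrable M (W T)" and expectation_W_T: "expectation (W T) = 0"
proof -
  have *: "W T \<omega> = 1 * (W T \<omega> - W 0 \<omega>)" if "\<omega> \<in> space M" for \<omega>
    using W_0[OF that] by simp
  have "integrable M (\<lambda>\<omega>. 1 * (W T \<omega> - W 0 \<omega>))"
    by (rule integrable_adapted_increment) (use T_pos in auto)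
  then show "integrable M (W T)"
    by (subst Bochner_Integration.integrable_cong[OF refl *])
  have "expectation (W T) = expectation (\<lambda>\<omega>. 1 * (W T \<omega> - W 0 \<omega>))"
    by (rule Bochner_Integration.integral_cong[OF refl *])
  also have "\<dots> = 0"
    by (rule expectation_adapted_increment) (use T_pos in auto)
  finally show "expectation (W T) = 0" .
qed

text \<open>\<open>W T\<close> has mean zero, so its coefficient is irrelevant. Measurability of
  \<open>X T\<close> is required to replace the logarithm by an almost everywhere equal function
  under the integral.\<close>

lemma expected_log_growth_affine:
  assumes X: "AE \<omega> in M. ln (X T \<omega> / X0) = k + l * W T \<omega>" "X T \<in> borel_measurable M"
  shows "expected_log_growth M T X0 X = k"
proof -
  have [measurable]: "W T \<in> borel_measurable M" "X T \<in> borel_measurable M"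
    using W_T_integrable X(2) by auto
  have "expected_log_growth M T X0 X = expectation (\<lambda>\<omega>. k + l * W T \<omega>)"
    unfolding expected_log_growth_def by (rule integral_cong_AE[OF _ _ X(1)]) measurable
  also have "\<dots> = k" using W_T_integrable expectation_W_T by (simp add: prob_space)
  finally show ?thesis .
qed

lemma measurable_at_T:
  assumes "case_prod X \<in> borel_measurable (time_interval T \<Otimes>\<^sub>M M)"
  shows "X T \<in> borel_measurable M"
  using measurable_compose[OF measurable_Pair1' assms, of T] T_pos by (simp add: space_restrict_space)

lemma ordinary_growth:
  assumes "ordinary_wealth M T W r \<mu> \<sigma> X0 \<pi> X" "X0 > 0"
  shows "expected_log_growth M T X0 X = (r + \<pi> * (\<mu> - r) - \<pi>\<^sup>2 * \<sigma>\<^sup>2 / 2) * T"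
proof -
  interpret linear_ito_equation M T W X "r * (1 - \<pi>) + \<pi> * \<mu>" "\<pi> * \<sigma>" X0
    using assms by unfold_locales (auto simp: ordinary_wealth_def)
  show ?thesis
  proof (rule expected_log_growth_affine)
    show "AE \<omega> in M. ln (X T \<omega> / X0) = (r + \<pi> * (\<mu> - r) - \<pi>\<^sup>2 * \<sigma>\<^sup>2 / 2) * T + (\<pi> * \<sigma>) * W T \<omega>"
      using X_T_eq
    proof eventually_elim
      case (elim \<omega>)
      then have "X T \<omega> / X0 = exp ((r * (1 - \<pi>) + \<pi> * \<mu>) * T + (\<pi> * \<sigma> * W T \<omega> - (\<pi> * \<sigma>)\<^sup>2 * T / 2))"
        using assms(2) by (simp add: exp_mart_def exp_add)
      then have "ln (X T \<omega> / X0) = (r * (1 - \<pi>) + \<pi> * \<mu>) * T + (\<pi> * \<sigma> * W T \<omega> - (\<pi> * \<sigma>)\<^sup>2 * T / 2)"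
        by (simp only: ln_exp)
      then show ?case by (simp add: algebra_simps power_mult_distrib)
    qed
    show "X T \<in> borel_measurable M" by (rule measurable_at_T[OF X_meas])
  qed
qed

text \<open>The information drift removes exactly \<pi> \<sigma> \<open>W T\<close>, so the log
  wealth is almost surely constant: the coefficient of \<open>W T\<close> is 0, and the known
  terminal value enters as \<pi> \<sigma> b.\<close>

lemma forward_growth:
  assumes "forward_wealth M T W r \<mu> \<sigma> X0 b \<pi> X"
  shows "expected_log_growth M T X0 X = (r + \<pi> * (\<mu> - r) - \<pi>\<^sup>2 * \<sigma>\<^sup>2 / 2) * T + \<pi> * \<sigma> * b"
proof (rule expected_log_growth_affine)
  have const: "(LINT t:{0..T}|lborel. k) = T * k" for k :: real
    using T_pos by (simp add: set_lebesgue_integral_def)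
  have "AE \<omega> in M. ln (X T \<omega> / X0) = (LINT t:{0..T}|lborel.
       r * (1 - \<pi>) + \<pi> * \<mu> - \<pi> * \<sigma> * ((W T \<omega> - b) / T) - 1 / 2 * \<pi>\<^sup>2 * \<sigma>\<^sup>2) + \<pi> * \<sigma> * W T \<omega>"
    using assms by (simp add: forward_wealth_def)
  then show "AE \<omega> in M. ln (X T \<omega> / X0) =
      (r + \<pi> * (\<mu> - r) - \<pi>\<^sup>2 * \<sigma>\<^sup>2 / 2) * T + \<pi> * \<sigma> * b + 0 * W T \<omega>"
    unfolding const
  proof eventually_elim
    case (elim \<omega>)
    \<comment> \<open>Naming the quotient and eliminating \<open>W T\<close> turns the claim into a
      polynomial identity.\<close>
    define q where "q = (W T \<omega> - b) / T"
    have q: "W T \<omega> = b + T * q" using T_pos by (simp add: q_def)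
    show ?case using elim unfolding q_def[symmetric] unfolding q by (simp add: algebra_simps)
  qed
  show "X T \<in> borel_measurable M"
    using assms by (intro measurable_at_T) (simp add: forward_wealth_def)
qed

text \<open>At t = T the correction term of the closed form equals \<pi>^2 \<sigma>^2 T / 2 and
  cancels the volatility penalty, so the growth is affine in \<pi>. The noise cancels as for the
  forward insider.\<close>

lemma skorokhod_growth:
  assumes "skorokhod_wealth M T W r \<mu> \<sigma> X0 b \<pi> X" "X0 > 0"
  shows "expected_log_growth M T X0 X = (r + \<pi> * (\<mu> - r)) * T + \<pi> * \<sigma> * b"
proof (rule expected_log_growth_affine)
  have "AE \<omega> in M. X T \<omega> = X0 * exp (\<pi> * \<sigma> * W T \<omega>
          + ((1 - \<pi>) * r + \<pi> * \<mu> + \<pi> * \<sigma> * ((b - W T \<omega>) / T) - 1 / 2 * \<pi>\<^sup>2 * \<sigma>\<^sup>2) * T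
          + 1 / (2 * T) * \<pi>\<^sup>2 * \<sigma>\<^sup>2 * T\<^sup>2)"
    using assms T_pos by (simp add: skorokhod_wealth_def)
  then show "AE \<omega> in M. ln (X T \<omega> / X0) = (r + \<pi> * (\<mu> - r)) * T + \<pi> * \<sigma> * b + 0 * W T \<omega>"
  proof eventually_elim
    case (elim \<omega>)
    define q where "q = (b - W T \<omega>) / T"
    have q: "W T \<omega> = b - T * q" using T_pos by (simp add: q_def)
    have "1 / (2 * T) * \<pi>\<^sup>2 * \<sigma>\<^sup>2 * T\<^sup>2 = \<pi>\<^sup>2 * \<sigma>\<^sup>2 * T / 2"
      using T_pos by (simp add: power2_eq_square[of T])
    then have "\<pi> * \<sigma> * W T \<omega> + ((1 - \<pi>) * r + \<pi> * \<mu> + \<pi> * \<sigma> * ((b - W T \<omega>) / T) - 1 / 2 * \<pi>\<^sup>2 * \<sigma>\<^sup>2) * T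
          + 1 / (2 * T) * \<pi>\<^sup>2 * \<sigma>\<^sup>2 * T\<^sup>2 = (r + \<pi> * (\<mu> - r)) * T + \<pi> * \<sigma> * b + 0 * W T \<omega>"
      unfolding q_def[symmetric] unfolding q by (simp add: algebra_simps)
    moreover have "X0 * y / X0 = y" for y using assms(2) by simp
    ultimately show ?case unfolding elim by (simp only: ln_exp)
  qed
  show "X T \<in> borel_measurable M"
    using assms by (intro measurable_at_T) (simp add: skorokhod_wealth_def)
qed

end

section \<open>Comparison of the optimal growth rates\<close>

lemma ex_is_maximum:
  assumes "continuous_on {0..1} g" "\<And>x. x \<in> {0..1} \<Longrightarrow> f x = g x"
  shows "\<exists>v. is_maximum f {0..1} v"
proof -
  obtain x where "x \<in> {0..1}" "\<forall>y\<in>{0..1}. g y \<le> g x"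
    using continuous_attains_sup[of "{0..1::real}" g] assms(1) by auto
  then show ?thesis
    unfolding is_maximum_def using assms(2) by (intro exI[of _ "g x"]) auto
qed

text \<open>\<open>is_maximum\<close> determines its value uniquely, so the quantified
  \<open>Vho\<close>, \<open>Vfw\<close> and \<open>Vsk\<close> are the maxima themselves, and their
  existence is part of the claim.\<close>

theorem mainTheorem3:
  fixes M :: "'a measure"
    and W :: "real \<Rightarrow> 'a \<Rightarrow> real"
    and T \<sigma> \<mu> r X0 :: real
    and Xho :: "real \<Rightarrow> real \<Rightarrow> 'a \<Rightarrow> real"
    and Xfw Xsk :: "real \<Rightarrow> real \<Rightarrow> real \<Rightarrow> 'a \<Rightarrow> real"
  assumes "T > 0" and "\<sigma> > 0" and "X0 > 0"
    and "(\<mu> - r) / \<sigma> > 0"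
    and "brownian_motion M T W"
    and "\<And>\<pi>. \<pi> \<in> {0..1} \<Longrightarrow> ordinary_wealth M T W r \<mu> \<sigma> X0 \<pi> (Xho \<pi>)"
    and "\<And>b \<pi>. \<pi> \<in> {0..1} \<Longrightarrow> forward_wealth M T W r \<mu> \<sigma> X0 b \<pi> (Xfw b \<pi>)"
    and "\<And>b \<pi>. \<pi> \<in> {0..1} \<Longrightarrow> skorokhod_wealth M T W r \<mu> \<sigma> X0 b \<pi> (Xsk b \<pi>)"
  shows "\<exists>Vho Vfw Vsk.
           is_maximum (\<lambda>\<pi>. expected_log_growth M T X0 (Xho \<pi>)) {0..1} Vho \<and>
           (\<forall>b. is_maximum (\<lambda>\<pi>. expected_log_growth M T X0 (Xfw b \<pi>)) {0..1} (Vfw b)) \<and>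
           (\<forall>b. is_maximum (\<lambda>\<pi>. expected_log_growth M T X0 (Xsk b \<pi>)) {0..1} (Vsk b)) \<and>
           (\<exists>b\<^sub>0. \<forall>b<b\<^sub>0. Vho > Vfw b \<and> Vho > Vsk b)"
proof -
  interpret brownian M T W using assms(1,5) by unfold_locales
  have \<mu>r: "\<mu> - r > 0" using assms(2,4) by (simp add: zero_less_divide_iff)
  note ho = ordinary_growth[OF assms(6) assms(3)] and fw = forward_growth[OF assms(7)]
    and sk = skorokhod_growth[OF assms(8) assms(3)]
  have "\<exists>v. is_maximum (\<lambda>\<pi>. expected_log_growth M T X0 (Xho \<pi>)) {0..1} v"
    by (rule ex_is_maximum[OF _ ho]) (auto intro!: continuous_intros)
  then obtain Vho where Vho: "is_maximum (\<lambda>\<pi>. expected_log_growth M T X0 (Xho \<pi>)) {0..1} Vho" ..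
  have "\<exists>v. is_maximum (\<lambda>\<pi>. expected_log_growth M T X0 (Xfw b \<pi>)) {0..1} v" for b
    by (rule ex_is_maximum[OF _ fw]) (auto intro!: continuous_intros)
  then obtain Vfw where Vfw: "\<And>b. is_maximum (\<lambda>\<pi>. expected_log_growth M T X0 (Xfw b \<pi>)) {0..1} (Vfw b)"
    by metis
  have "\<exists>v. is_maximum (\<lambda>\<pi>. expected_log_growth M T X0 (Xsk b \<pi>)) {0..1} v" for b
    by (rule ex_is_maximum[OF _ sk]) (auto intro!: continuous_intros)
  then obtain Vsk where Vsk: "\<And>b. is_maximum (\<lambda>\<pi>. expected_log_growth M T X0 (Xsk b \<pi>)) {0..1} (Vsk b)"
    by metis
  have Vho_gt: "Vho > r * T"
  proof -
    \<comment> \<open>The Merton proportion, which is the unconstrained maximiser of the ordinary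
      growth, capped at 1. At it or below it the excess return outweighs the volatility
      penalty.\<close>
    define p where "p = min 1 ((\<mu> - r) / \<sigma>\<^sup>2)"
    have p: "0 < p" "p \<in> {0..1}" using \<mu>r assms(2) by (auto simp: p_def)
    have "p * \<sigma>\<^sup>2 \<le> (\<mu> - r) / \<sigma>\<^sup>2 * \<sigma>\<^sup>2" unfolding p_def by (intro mult_right_mono) auto
    then have "p * \<sigma>\<^sup>2 \<le> \<mu> - r" using assms(2) by simp
    then have "0 < p * ((\<mu> - r) - p * \<sigma>\<^sup>2 / 2)" using p(1) \<mu>r by (intro mult_pos_pos) auto
    then have "r * T < (r + p * (\<mu> - r) - p\<^sup>2 * \<sigma>\<^sup>2 / 2) * T"
      using assms(1) by (intro mult_strict_right_mono) (auto simp: algebra_simps power2_eq_square)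
    also have "\<dots> \<le> Vho" using Vho p(2) ho[OF p(2)] unfolding is_maximum_def by metis
    finally show ?thesis .
  qed
  \<comment> \<open>At the threshold the slope (\<mu> - r) T + \<sigma> b of the Skorokhod growth in
    \<pi> vanishes; below it a positive \<pi> can gain nothing. The forward growth is smaller still
    by its penalty term.\<close>
  have bound: "\<pi> * (\<mu> - r) * T + \<pi> * \<sigma> * b \<le> 0"
    if "b < - (\<mu> - r) * T / \<sigma>" "\<pi> \<in> {0..1}" for b \<pi>
  proof -
    have "\<sigma> * b \<le> - (\<mu> - r) * T" using that(1) assms(2) by (simp add: field_simps)
    then have "\<pi> * (\<sigma> * b) \<le> \<pi> * (- (\<mu> - r) * T)" using that(2) by (intro mult_left_mono) auto
    then show ?thesis by (simp add: algebra_simps)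
  qed
  have "Vfw b < Vho \<and> Vsk b < Vho" if b: "b < - (\<mu> - r) * T / \<sigma>" for b
  proof
    obtain \<pi> where \<pi>: "\<pi> \<in> {0..1}" "Vfw b = (r + \<pi> * (\<mu> - r) - \<pi>\<^sup>2 * \<sigma>\<^sup>2 / 2) * T + \<pi> * \<sigma> * b"
      using Vfw[of b] fw unfolding is_maximum_def by metis
    have "0 \<le> \<pi>\<^sup>2 * \<sigma>\<^sup>2 / 2 * T" using assms(1) by simp
    then have "Vfw b \<le> r * T" using bound[OF b \<pi>(1)] unfolding \<pi>(2) by (simp add: algebra_simps)
    then show "Vfw b < Vho" using Vho_gt by simp
    obtain \<rho> where \<rho>: "\<rho> \<in> {0..1}" "Vsk b = (r + \<rho> * (\<mu> - r)) * T + \<rho> * \<sigma> * b"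
      using Vsk[of b] sk unfolding is_maximum_def by metis
    have "Vsk b \<le> r * T" using bound[OF b \<rho>(1)] unfolding \<rho>(2) by (simp add: algebra_simps)
    then show "Vsk b < Vho" using Vho_gt by simp
  qed
  then show ?thesis using Vho Vfw Vsk by blast
qed

end
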